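(* The sub-Lorentzian distance $d(q)=d(q_0,q)$ from $q_0=(0,0,0)$ in the problem described in the context is real-analytic on $\operatorname{int}\mathcal A_2$ and continuous on $M$.
   Context: Let $M=\mathbb R^3$ with coordinates $(x,y,z)$, $X_1=\frac{\partial}{\partial x}$, $X_2=\frac{\partial}{\partial y}+\frac{x^2}{2}\frac{\partial}{\partial z}$, $U_2=\{(u_1,u_2)\in\mathbb R^2: u_1\ge|u_2|\}$. An admissible trajectory is a Lipschitz curve $q:[0,t_1]\to M$ ($t_1\ge0$ free) with $\dot q=u_1X_1(q)+u_2X_2(q)$ a.e. for some bounded measurable control $u:[0,t_1]\to U_2$; its length is $l=\int_0^{t_1}\sqrt{u_1^2-u_2^2}\,dt$. $\mathcal A_2$ is the set of endpoints of admissible trajectories starting at $q_0$. For $q\in\mathcal A_2$, $d(q_0,q)$ is the supremum of lengths of admissible trajectories from $q_0$ to $q$; for $q\notin\mathcal A_2$, $d(q_0,q)=0$. *)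

theory Defs
  imports "HOL-Analysis.Analysis"
begin

definition X1 :: "real^3 \<Rightarrow> real^3" where
  "X1 q = vector [1, 0, 0]"

definition X2 :: "real^3 \<Rightarrow> real^3" where
  "X2 q = vector [0, 1, (q $ 1)\<^sup>2 / 2]"

definition U2 :: "(real^2) set" where
  "U2 = {u. u $ 1 \<ge> \<bar>u $ 2\<bar>}"

text \<open>Only the values of \<open>q\<close> and \<open>u\<close> on \<open>{0..t1}\<close> matter. Measurability is in the sense of Lebesgue.\<close>

definition admissible :: "real \<Rightarrow> (real \<Rightarrow> real^2) \<Rightarrow> (real \<Rightarrow> real^3) \<Rightarrow> bool" where
  "admissible t1 u q \<longleftrightarrow>
     0 \<le> t1 \<and>
     (\<exists>L. L-lipschitz_on {0..t1} q) \<and>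
     u \<in> borel_measurable (lebesgue_on {0..t1}) \<and>
     bounded (u ` {0..t1}) \<and>
     (\<forall>t\<in>{0..t1}. u t \<in> U2) \<and>
     (AE t in lebesgue_on {0..t1}.
        (q has_vector_derivative u t $ 1 *\<^sub>R X1 (q t) + u t $ 2 *\<^sub>R X2 (q t))
          (at t within {0..t1}))"

text \<open>Since \<open>X1\<close> and \<open>X2\<close> are linearly independent at every point, the control is determined
  almost everywhere by the trajectory, so the length may be read off the control.\<close>

definition traj_length :: "real \<Rightarrow> (real \<Rightarrow> real^2) \<Rightarrow> real" where
  "traj_length t1 u = (LINT t|lebesgue_on {0..t1}. sqrt ((u t $ 1)\<^sup>2 - (u t $ 2)\<^sup>2))"

definition attainable :: "real^3 \<Rightarrow> (real^3) set" where
  "attainable q0 = {q t1 | t1 u q. admissible t1 u q \<and> q 0 = q0}"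

text \<open>The lengths of the admissible trajectories from \<open>q0\<close> to \<open>p\<close> are bounded above by
  \<open>p $ 1 - q0 $ 1\<close> (the integrand is at most \<open>u t $ 1\<close>), so the real-valued supremum is the
  genuine one.\<close>

definition sub_Lorentzian_dist :: "real^3 \<Rightarrow> real^3 \<Rightarrow> real" where
  "sub_Lorentzian_dist q0 p =
     (if p \<in> attainable q0
      then Sup {traj_length t1 u | t1 u q. admissible t1 u q \<and> q 0 = q0 \<and> q t1 = p}
      else 0)"

text \<open>Real analyticity on an open set: near every point of the set the function is the sum of a
  (multivariate, unconditionally convergent) power series; \<open>nat^'n\<close> is the type of multi-indices.\<close>

definition real_analytic_on :: "(real^'n \<Rightarrow> real) \<Rightarrow> (real^'n) set \<Rightarrow> bool" where
  "real_analytic_on f S \<longleftrightarrow>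
     (\<forall>p\<in>S. \<exists>r>0. \<exists>c :: nat^'n \<Rightarrow> real. \<forall>x\<in>ball p r.
        ((\<lambda>\<alpha>. c \<alpha> * (\<Prod>i\<in>UNIV. (x $ i - p $ i) ^ (\<alpha> $ i))) has_sum f x) UNIV)"

end

theory Submission
  imports Defs "HOL-Complex_Analysis.Cauchy_Integral_Formula"
begin

text \<open>Since \<open>u $ 1 \<ge> \<bar>u $ 2\<bar>\<close>, the first coordinate can serve as time. With \<open>X\<close>, \<open>Y\<close>, \<open>Z\<close> the
coordinates of the endpoint, \<open>X > 0\<close>, the problem becomes: among all functions \<open>w\<close> with
\<open>\<bar>w\<bar> \<le> 1\<close> on \<open>[0, 1]\<close> whose moments \<open>\<integral> w\<close> and \<open>\<integral> s\<^sup>2 w\<close> are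
\<open>\<eta> = Y / X\<close> and \<open>\<zeta> = 2 Z / X\<^sup>3\<close>, maximise \<open>X \<integral> sqrt (1 - w\<^sup>2)\<close>. This is a concave problem and
it is solved by duality. For multipliers \<open>a\<close>, \<open>b\<close> put \<open>h s = a + b s\<^sup>2\<close> and
\<open>\<Phi> (a, b) = \<integral> sqrt (1 + h\<^sup>2)\<close> (\<open>energy\<close>). The Cauchy-Schwarz inequality
\<open>sqrt (1 - w\<^sup>2) \<le> sqrt (1 + h\<^sup>2) - h w\<close> gives the upper bound
\<open>X (\<Phi> (a, b) - a \<eta> - b \<zeta>)\<close> for every length, for all \<open>a\<close>, \<open>b\<close> (\<open>length_le_dual\<close>), and equality holds for
\<open>w = h / sqrt (1 + h\<^sup>2)\<close>. Hence, whenever \<open>(\<eta>, \<zeta>)\<close> is the gradient of \<open>\<Phi>\<close> at \<open>(a, b)\<close>, that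
is, the pair of moments of this \<open>w\<close>, the distance is \<open>X \<integral> 1 / sqrt (1 + h\<^sup>2)\<close>
(\<open>extremal_endpoint_dist\<close>).

A point with \<open>X > 0\<close> falls under one of two cases (\<open>extremal_or_supported\<close>). Either
\<open>\<integral> \<bar>h\<bar> > a \<eta> + b \<zeta>\<close> for all nonzero \<open>(a, b)\<close>; then \<open>\<Phi> (a, b) - a \<eta> - b \<zeta>\<close> is
coercive, and its minimiser gives multipliers. Or some nonzero \<open>(a, b)\<close> has
\<open>\<integral> \<bar>h\<bar> \<le> a \<eta> + b \<zeta>\<close>; this excludes interior points of the attainable set, and the upper bound
at \<open>(n a, n b)\<close>, \<open>n \<rightarrow> \<infinity>\<close>, forces the distance to vanish.

Analyticity. The moments are given by integrals that extend holomorphically to complex \<open>a\<close>, \<open>b\<close> with small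
imaginary parts, and their Jacobian at real points is positive definite. The inverse function theorem
then expresses the multipliers holomorphically through \<open>(\<eta>, \<zeta>)\<close>
(\<open>opt_length_locally_holomorphic\<close>), so that near an interior point the distance is the real part
of a holomorphic function of three complex variables. Such a function has a power series by repeated
one-variable Taylor expansion (\<open>Osgood_power_series_3\<close>).

Continuity. At points with multipliers it follows from the same holomorphic extension. At every other
point the distance is zero, and the upper bound for fixed multipliers, which depends continuously on
the endpoint, makes it small nearby.\<close>

section \<open>Fundamental theorem of calculus for Lipschitz functions\<close>

text \<open>The Riemann sums are compared with \<open>f b - f a\<close> interval by interval. At tags outside \<open>N\<close> the
differentiability of \<open>f\<close> controls the error. At tags in \<open>N\<close> the increment of \<open>f\<close> is at most \<open>L\<close>
times the length of the interval, and the total length of those intervals is a Riemann sum of the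
indicator function of \<open>N\<close>, whose integral is zero.\<close>

theorem fundamental_theorem_of_calculus_Lipschitz:
  fixes f :: "real \<Rightarrow> 'a::banach"
  assumes "a \<le> b" and lip: "L-lipschitz_on {a..b} f" and neg: "negligible N"
    and vecd: "\<And>x. x \<in> {a..b} - N \<Longrightarrow> (f has_vector_derivative f' x) (at x within {a..b})"
  shows "(f' has_integral (f b - f a)) {a..b}"
proof -
  have L: "L \<ge> 0"
    using lip lipschitz_on_nonneg by blast
  \<comment> \<open>Values on \<open>N\<close> do not affect the integral; with zero there, such tags contribute nothing to the Riemann sum.\<close>
  define h where "h x = (if x \<in> N then 0 else f' x)" for x
  have "(h has_integral (f b - f a)) (cbox a b)"
    unfolding has_integral
  proof safe
    fix e :: real
    assume e: "e > 0"
    \<comment> \<open>The shares of \<open>e\<close> allotted to the tags outside and inside \<open>N\<close>; the summands 1 avoid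
      division by zero when \<open>a = b\<close> or \<open>L = 0\<close>.\<close>
    define e1 where "e1 = e / (2 * (b - a + 1))"
    have e1: "e1 > 0" "e1 * (b - a) < e / 2"
      using e \<open>a \<le> b\<close> by (auto simp: e1_def field_simps)
    define e2 where "e2 = e / (2 * (L + 1))"
    have e2: "e2 > 0" "L * e2 \<le> e / 2"
      using e L by (auto simp: e2_def field_simps)
    have "\<forall>x. \<exists>d>0. x \<in> {a..b} - N \<longrightarrow>
           (\<forall>y\<in>{a..b}. norm (y-x) < d \<longrightarrow> norm (f y - f x - (y-x) *\<^sub>R f' x) \<le> e1 * norm (y-x))"
      using vecd e1(1) unfolding has_vector_derivative_def has_derivative_within_alt
      by (metis zero_less_one)
    then obtain d where d: "\<And>x. 0 < d x"
                   "\<And>x y. \<lbrakk>x \<in> {a..b} - N; y \<in> {a..b}; norm (y-x) < d x\<rbrakk>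
                          \<Longrightarrow> norm (f y - f x - (y-x) *\<^sub>R f' x) \<le> e1 * norm (y-x)"
      by metis
    have "(indicat_real N has_integral 0) (cbox a b)"
      using neg unfolding negligible_def by blast
    from this[unfolded has_integral, rule_format, OF e2(1)]
    obtain \<gamma> where \<gamma>: "gauge \<gamma>"
      "\<And>p. p tagged_division_of cbox a b \<Longrightarrow> \<gamma> fine p \<Longrightarrow>
         norm ((\<Sum>(x, K)\<in>p. measure lborel K *\<^sub>R indicat_real N x) - 0) < e2"
      by meson
    show "\<exists>\<gamma>. gauge \<gamma> \<and> (\<forall>p. p tagged_division_of cbox a b \<and> \<gamma> fine p \<longrightarrow>
            norm ((\<Sum>(x, K)\<in>p. measure lborel K *\<^sub>R h x) - (f b - f a)) < e)"
    proof (rule exI[of _ "\<lambda>x. \<gamma> x \<inter> ball x (d x)"], intro conjI allI impI)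
      show "gauge (\<lambda>x. \<gamma> x \<inter> ball x (d x))"
        using d(1) by (intro gauge_Int \<gamma>(1) gauge_ball_dependent) auto
    next
      fix p
      assume p: "p tagged_division_of cbox a b \<and> (\<lambda>x. \<gamma> x \<inter> ball x (d x)) fine p"
      then have ptag: "p tagged_division_of cbox a b"
        and fine1: "\<gamma> fine p" and fine2: "(\<lambda>x. ball x (d x)) fine p"
        by (auto simp: fine_Int)
      have ba: "b - a = (\<Sum>(x,K)\<in>p. Sup K - Inf K)" "f b - f a = (\<Sum>(x,K)\<in>p. f(Sup K) - f(Inf K))"
        using additive_tagged_division_1[where f= "\<lambda>x. x"] additive_tagged_division_1[where f= f]
              \<open>a \<le> b\<close> ptag by auto
      have "norm (\<Sum>(x, K) \<in> p. (measure lborel K *\<^sub>R h x) - (f (Sup K) - f (Inf K)))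
            \<le> (\<Sum>(x, K) \<in> p. e1 * (Sup K - Inf K) + L * (measure lborel K * indicat_real N x))"
      proof (rule sum_norm_le, safe)
        fix x K
        assume xK: "(x, K) \<in> p"
        then have "x \<in> K" and kab: "K \<subseteq> cbox a b"
          using ptag by blast+
        then obtain u v where k: "K = cbox u v"
          using ptag xK by auto
        have "u \<le> v"
          using \<open>x \<in> K\<close> unfolding k by auto
        have uvK: "u \<in> K" "v \<in> K"
          by (simp_all add: \<open>u \<le> v\<close> k)
        have uvab: "u \<in> {a..b}" "v \<in> {a..b}" "x \<in> {a..b}"
          using uvK kab \<open>x \<in> K\<close> by auto
        have uxv: "u \<le> x" "x \<le> v"
          using \<open>x \<in> K\<close> unfolding k by auto
        have SI: "Sup K = v" "Inf K = u" "measure lborel K = v - u"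
          using \<open>u \<le> v\<close> by (auto simp: k)
        show "norm (measure lborel K *\<^sub>R h x - (f (Sup K) - f (Inf K)))
          \<le> e1 * (Sup K - Inf K) + L * (measure lborel K * indicat_real N x)"
        proof (cases "x \<in> N")
          case True
          have "norm (f v - f u) \<le> L * (v - u)"
            using lipschitz_onD[OF lip uvab(2,1)] \<open>u \<le> v\<close> by (simp add: dist_norm)
          moreover have "0 \<le> e1 * (v - u)"
            using e1(1) \<open>u \<le> v\<close> by simp
          ultimately show ?thesis
            using True by (simp add: SI h_def norm_minus_commute)
        next
          case False
          have ball: "\<forall>y\<in>K. y \<in> ball x (d x)"
            using fine2 xK by blast
          have "norm ((v - u) *\<^sub>R f' x - (f v - f u)) = norm (f u - f x - (u - x) *\<^sub>R f' x - (f v - f x - (v - x) *\<^sub>R f' x))"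
            by (auto simp: algebra_simps)
          also have "\<dots> \<le> norm (f u - f x - (u - x) *\<^sub>R f' x) + norm (f v - f x - (v - x) *\<^sub>R f' x)"
            by (rule norm_triangle_ineq4)
          also have "\<dots> \<le> e1 * norm (u - x) + e1 * norm (v - x)"
            using ball uvK uvab False
            by (intro add_mono d(2)) (auto simp: dist_norm norm_minus_commute)
          also have "\<dots> = e1 * (v - u)"
            using uxv by (simp add: algebra_simps)
          finally show ?thesis
            using False by (simp add: SI h_def)
        qed
      qed
      also have "\<dots> = e1 * (b - a) + L * (\<Sum>(x, K)\<in>p. measure lborel K *\<^sub>R indicat_real N x)"
        by (simp add: ba(1) sum.distrib sum_distrib_left case_prod_unfold)
      also have "\<dots> < e"
      proof -
        have "(\<Sum>(x, K)\<in>p. measure lborel K *\<^sub>R indicat_real N x) \<le> e2"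
          using \<gamma>(2)[OF ptag fine1] by (simp add: abs_less_iff)
        then have "L * (\<Sum>(x, K)\<in>p. measure lborel K *\<^sub>R indicat_real N x) \<le> L * e2"
          by (rule mult_left_mono[OF _ L])
        then show ?thesis
          using e1 e2 by linarith
      qed
      finally show "norm ((\<Sum>(x, K)\<in>p. measure lborel K *\<^sub>R h x) - (f b - f a)) < e"
        by (simp add: ba(2) sum_subtractf case_prod_unfold)
    qed
  qed
  then have "(h has_integral (f b - f a)) {a..b}"
    by simp
  then show ?thesis
    by (rule has_integral_spike[OF neg, rotated]) (auto simp: h_def)
qed

section \<open>Admissible trajectories and extremals\<close>

lemma continuous_on_vector_3:
  fixes f g h :: "'a::topological_space \<Rightarrow> 'b::{topological_space, zero}"
  assumes "continuous_on S f" "continuous_on S g" "continuous_on S h"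
  shows "continuous_on S (\<lambda>x. vector [f x, g x, h x] :: 'b^3)"
proof -
  have eq: "(\<lambda>x. vector [f x, g x, h x] :: 'b^3)
      = (\<lambda>x. \<chi> i::3. (if i = 1 then f else if i = 2 then g else h) x)"
    by (simp add: fun_eq_iff vec_eq_iff forall_3)
  show ?thesis
    unfolding eq by (rule continuous_on_vec_lambda) (simp add: assms)
qed

lemma continuous_on_UNIV_composeI:
  "continuous_on UNIV g \<Longrightarrow> continuous_on S f \<Longrightarrow> continuous_on S (\<lambda>x. g (f x))"
  by (rule continuous_on_compose2) auto

lemma bounded_vector_derivative_imp_Lipschitz:
  fixes f :: "real \<Rightarrow> 'a::real_normed_vector"
  assumes "convex S" "0 \<le> B"
    and deriv: "\<And>x. x \<in> S \<Longrightarrow> (f has_vector_derivative f' x) (at x within S)"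
    and bound: "\<And>x. x \<in> S \<Longrightarrow> norm (f' x) \<le> B"
  shows "B-lipschitz_on S f"
proof (rule lipschitz_onI)
  fix x y assume "x \<in> S" "y \<in> S"
  moreover have "onorm (\<lambda>h. h *\<^sub>R f' z) \<le> B" if "z \<in> S" for z
    using bound[OF that] by (intro onorm_le) (simp add: mult.commute[of B] mult_left_mono)
  ultimately show "dist (f x) (f y) \<le> B * dist x y"
    unfolding dist_norm
    using deriv by (intro differentiable_bound[OF \<open>convex S\<close>, where f' = "\<lambda>z h. h *\<^sub>R f' z"])
      (auto simp: has_vector_derivative_def)
qed fact

lemma admissible_derivatives:
  assumes "admissible t1 u q"
  obtains N where "negligible N"
    "\<And>t. t \<in> {0..t1} - N \<Longrightarrow> ((\<lambda>t. q t $ 1) has_vector_derivative u t $ 1) (at t within {0..t1})"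
    "\<And>t. t \<in> {0..t1} - N \<Longrightarrow> ((\<lambda>t. q t $ 2) has_vector_derivative u t $ 2) (at t within {0..t1})"
    "\<And>t. t \<in> {0..t1} - N \<Longrightarrow>
       ((\<lambda>t. q t $ 3) has_vector_derivative u t $ 2 * ((q t $ 1)\<^sup>2 / 2)) (at t within {0..t1})"
proof -
  let ?D = "\<lambda>t. (q has_vector_derivative u t $ 1 *\<^sub>R X1 (q t) + u t $ 2 *\<^sub>R X2 (q t)) (at t within {0..t1})"
  have "AE t in lebesgue_on {0..t1}. ?D t"
    using assms by (simp add: admissible_def)
  then obtain N where "N \<in> null_sets (lebesgue_on {0..t1})"
    and N: "{t \<in> space (lebesgue_on {0..t1}). \<not> ?D t} \<subseteq> N"
    unfolding eventually_ae_filter by blast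
  then have "negligible N"
    by (simp add: null_sets_restrict_space negligible_iff_null_sets)
  moreover have D: "?D t" if "t \<in> {0..t1} - N" for t
    using N that by auto
  have c: "((\<lambda>t. q t $ i) has_vector_derivative
      (u t $ 1 *\<^sub>R X1 (q t) + u t $ 2 *\<^sub>R X2 (q t)) $ i) (at t within {0..t1})"
    if "t \<in> {0..t1} - N" for t i
    by (rule bounded_linear.has_vector_derivative[OF bounded_linear_vec_nth D[OF that]])
  show thesis
  proof (rule that[OF \<open>negligible N\<close>])
    fix t assume t: "t \<in> {0..t1} - N"
    show "((\<lambda>t. q t $ 1) has_vector_derivative u t $ 1) (at t within {0..t1})"
      using c[OF t, of 1] by (simp add: X1_def X2_def)
    show "((\<lambda>t. q t $ 2) has_vector_derivative u t $ 2) (at t within {0..t1})"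
      using c[OF t, of 2] by (simp add: X1_def X2_def)
    show "((\<lambda>t. q t $ 3) has_vector_derivative u t $ 2 * ((q t $ 1)\<^sup>2 / 2)) (at t within {0..t1})"
      using c[OF t, of 3] by (simp add: X1_def X2_def)
  qed
qed

lemma admissible_component_Lipschitz:
  assumes "admissible t1 u q"
  obtains L where "L-lipschitz_on {0..t1} (\<lambda>t. q t $ i)"
proof -
  obtain L where L: "L-lipschitz_on {0..t1} q"
    using assms by (auto simp: admissible_def)
  have "L-lipschitz_on {0..t1} (\<lambda>t. q t $ i)"
  proof (rule lipschitz_onI)
    fix s t assume "s \<in> {0..t1}" "t \<in> {0..t1}"
    then have "dist (q s) (q t) \<le> L * dist s t"
      by (rule lipschitz_onD[OF L])
    then show "dist (q s $ i) (q t $ i) \<le> L * dist s t"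
      using dist_vec_nth_le[of "q s" i "q t"] by linarith
  qed (use L lipschitz_on_nonneg in blast)
  then show thesis by (rule that)
qed

text \<open>Substitution \<open>s = q t $ 1 / X\<close>. An antiderivative of \<open>\<phi>\<close> composed with the first coordinate is
Lipschitz, so the fundamental theorem applies although the control is merely measurable.\<close>

lemma admissible_integral_first:
  fixes \<phi> :: "real \<Rightarrow> real"
  assumes adm: "admissible t1 u q" and q0: "q 0 = 0" and X: "X = q t1 $ 1" "X > 0"
    and cont: "continuous_on UNIV \<phi>"
  shows "((\<lambda>t. \<phi> (q t $ 1 / X) * u t $ 1) has_integral X * integral {0..1} \<phi>) {0..t1}"
proof -
  obtain N where N: "negligible N"
    "\<And>t. t \<in> {0..t1} - N \<Longrightarrow> ((\<lambda>t. q t $ 1) has_vector_derivative u t $ 1) (at t within {0..t1})"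
    using admissible_derivatives[OF adm] by metis
  obtain L where L: "L-lipschitz_on {0..t1} (\<lambda>t. q t $ 1)"
    using admissible_component_Lipschitz[OF adm] by blast
  have L': "(\<bar>1 / X\<bar> * L)-lipschitz_on {0..t1} (\<lambda>t. 1 / X * q t $ 1)"
    by (rule lipschitz_on_cmult_real[OF L])
  have "compact ((\<lambda>t. q t $ 1 / X) ` {0..t1})"
    by (intro compact_continuous_image continuous_on_divide lipschitz_on_continuous_on[OF L]
        continuous_on_const) (use X(2) in auto)
  then obtain K0 where K0: "\<And>t. t \<in> {0..t1} \<Longrightarrow> \<bar>q t $ 1 / X\<bar> \<le> K0"
    using compact_imp_bounded[THEN bounded_real[THEN iffD1]] by fastforce
  \<comment> \<open>An interval that contains the whole curve \<open>q $ 1 / X\<close> as well as \<open>[0, 1]\<close>.\<close>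
  define K where "K = max 1 K0"
  have K: "(\<lambda>t. q t $ 1 / X) ` {0..t1} \<subseteq> {-K..K}" "K \<ge> 1"
  proof
    fix v assume "v \<in> (\<lambda>t. q t $ 1 / X) ` {0..t1}"
    then show "v \<in> {-K..K}"
      using K0 unfolding K_def abs_le_iff by (smt (verit) atLeastAtMost_iff imageE)
  qed (simp add: K_def)
  define G where "G = (\<lambda>v. integral {-K..v} \<phi>)"
  have G: "(G has_vector_derivative \<phi> v) (at v within {-K..K})" if "v \<in> {-K..K}" for v
    unfolding G_def using that continuous_on_subset[OF cont]
    by (intro integral_has_vector_derivative) auto
  have "compact (\<phi> ` {-K..K})"
    using continuous_on_subset[OF cont] by (intro compact_continuous_image) auto
  then obtain B where B: "\<And>v. v \<in> {-K..K} \<Longrightarrow> \<bar>\<phi> v\<bar> \<le> B"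
    using compact_imp_bounded[THEN bounded_real[THEN iffD1]] by fastforce
  have "0 \<le> B"
    using B[of 0] K(2) by force
  then have "B-lipschitz_on {-K..K} G"
    using B by (intro bounded_vector_derivative_imp_Lipschitz[OF _ _ G]) auto
  then have "B-lipschitz_on ((\<lambda>t. 1 / X * q t $ 1) ` {0..t1}) G"
    using K(1) by (auto elim: lipschitz_on_subset)
  from lipschitz_on_cmult_real[OF lipschitz_on_compose2[OF L' this], of X]
  have lip: "(\<bar>X\<bar> * (B * (\<bar>1 / X\<bar> * L)))-lipschitz_on {0..t1} (\<lambda>t. X * G (q t $ 1 / X))"
    by simp
  have t1: "0 \<le> t1"
    using adm by (simp add: admissible_def)
  have "((\<lambda>t. \<phi> (q t $ 1 / X) * u t $ 1) has_integral X * G (q t1 $ 1 / X) - X * G (q 0 $ 1 / X)) {0..t1}"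
  proof (rule fundamental_theorem_of_calculus_Lipschitz[OF t1 lip N(1)])
    fix t assume t: "t \<in> {0..t1} - N"
    have "((\<lambda>t. q t $ 1 / X) has_vector_derivative u t $ 1 / X) (at t within {0..t1})"
      by (rule has_vector_derivative_divide[OF N(2)[OF t]])
    moreover have "(G has_vector_derivative \<phi> (q t $ 1 / X)) (at (q t $ 1 / X) within (\<lambda>t. q t $ 1 / X) ` {0..t1})"
      using t K(1) by (intro has_vector_derivative_within_subset[OF G K(1)]) blast
    ultimately have "((G \<circ> (\<lambda>t. q t $ 1 / X)) has_vector_derivative (u t $ 1 / X) *\<^sub>R \<phi> (q t $ 1 / X)) (at t within {0..t1})"
      by (rule vector_diff_chain_within)
    from has_vector_derivative_mult_right[OF this, of X]
    show "((\<lambda>t. X * G (q t $ 1 / X)) has_vector_derivative \<phi> (q t $ 1 / X) * u t $ 1) (at t within {0..t1})"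
      using X(2) by (simp add: o_def mult.commute)
  qed
  moreover have "X * G (q t1 $ 1 / X) - X * G (q 0 $ 1 / X) = X * integral {0..1} \<phi>"
  proof -
    have "integral {-K..0} \<phi> + integral {0..1} \<phi> = integral {-K..1} \<phi>"
      using K(2) continuous_on_subset[OF cont]
      by (intro Henstock_Kurzweil_Integration.integral_combine integrable_continuous_real) auto
    then show ?thesis
      using X q0 by (simp add: G_def right_diff_distrib[symmetric])
  qed
  ultimately show ?thesis by simp
qed

lemma admissible_integral_control_1:
  assumes adm: "admissible t1 u q" and q0: "q 0 = 0"
  shows "((\<lambda>t. u t $ 1) has_integral q t1 $ 1) {0..t1}"
proof -
  obtain N where N: "negligible N"
    "\<And>t. t \<in> {0..t1} - N \<Longrightarrow> ((\<lambda>t. q t $ 1) has_vector_derivative u t $ 1) (at t within {0..t1})"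
    using admissible_derivatives[OF adm] by metis
  obtain L where L: "L-lipschitz_on {0..t1} (\<lambda>t. q t $ 1)"
    using admissible_component_Lipschitz[OF adm] by blast
  show ?thesis
    using fundamental_theorem_of_calculus_Lipschitz[OF _ L N] adm q0
    by (simp add: admissible_def)
qed

text \<open>The second and third coordinates of the endpoint are integrals of \<open>u $ 2\<close> against \<open>1\<close> and
\<open>x\<^sup>2 / 2\<close>; the factors \<open>1 / X\<^sup>2\<close> arise from measuring \<open>x\<close> in units of \<open>X\<close>.\<close>

lemma admissible_integral_second:
  assumes adm: "admissible t1 u q" and q0: "q 0 = 0"
  shows "((\<lambda>t. (a + b * (q t $ 1 / X)\<^sup>2) * u t $ 2) has_integral
           a * q t1 $ 2 + 2 * b / X\<^sup>2 * q t1 $ 3) {0..t1}"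
proof -
  obtain N where N: "negligible N"
    "\<And>t. t \<in> {0..t1} - N \<Longrightarrow> ((\<lambda>t. q t $ 2) has_vector_derivative u t $ 2) (at t within {0..t1})"
    "\<And>t. t \<in> {0..t1} - N \<Longrightarrow>
       ((\<lambda>t. q t $ 3) has_vector_derivative u t $ 2 * ((q t $ 1)\<^sup>2 / 2)) (at t within {0..t1})"
    using admissible_derivatives[OF adm] by metis
  have t1: "0 \<le> t1"
    using adm by (simp add: admissible_def)
  obtain L2 L3 where L: "L2-lipschitz_on {0..t1} (\<lambda>t. q t $ 2)" "L3-lipschitz_on {0..t1} (\<lambda>t. q t $ 3)"
    using admissible_component_Lipschitz[OF adm] by metis
  have "((\<lambda>t. u t $ 2) has_integral q t1 $ 2) {0..t1}"
       "((\<lambda>t. u t $ 2 * ((q t $ 1)\<^sup>2 / 2)) has_integral q t1 $ 3) {0..t1}"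
    using fundamental_theorem_of_calculus_Lipschitz[OF t1 L(1) N(1,2)]
      fundamental_theorem_of_calculus_Lipschitz[OF t1 L(2) N(1,3)] q0 by simp_all
  from has_integral_add[OF this[THEN has_integral_mult_right]]
  have "((\<lambda>t. a * u t $ 2 + 2 * b / X\<^sup>2 * (u t $ 2 * ((q t $ 1)\<^sup>2 / 2))) has_integral
      a * q t1 $ 2 + 2 * b / X\<^sup>2 * q t1 $ 3) {0..t1}" .
  then show ?thesis
    by (rule has_integral_eq[rotated]) (simp add: power_divide algebra_simps)
qed

lemma admissible_length_has_integral:
  assumes "admissible t1 u q"
  shows "((\<lambda>t. sqrt ((u t $ 1)\<^sup>2 - (u t $ 2)\<^sup>2)) has_integral traj_length t1 u) {0..t1}"
proof -
  have meas: "u \<in> borel_measurable (lebesgue_on {0..t1})" and "bounded (u ` {0..t1})"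
    using assms by (auto simp: admissible_def)
  then obtain B where B: "\<And>t. t \<in> {0..t1} \<Longrightarrow> norm (u t) \<le> B"
    unfolding bounded_iff by blast
  have U: "\<bar>u t $ 2\<bar> \<le> u t $ 1" if "t \<in> {0..t1}" for t
    using assms that by (auto simp: admissible_def U2_def)
  have "(\<lambda>t. sqrt ((u t $ 1)\<^sup>2 - (u t $ 2)\<^sup>2)) \<in> borel_measurable (lebesgue_on {0..t1})"
    by (rule borel_measurable_continuous_on[OF _ meas, where f = "\<lambda>v. sqrt ((v $ 1)\<^sup>2 - (v $ 2)\<^sup>2)"])
       (intro continuous_intros)
  moreover have "norm (sqrt ((u t $ 1)\<^sup>2 - (u t $ 2)\<^sup>2)) \<le> B" if t: "t \<in> {0..t1}" for t
  proof -
    have "(u t $ 2)\<^sup>2 \<le> (u t $ 1)\<^sup>2"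
      using U[OF t] by (intro abs_le_square_iff[THEN iffD1]) simp
    moreover have "sqrt ((u t $ 1)\<^sup>2 - (u t $ 2)\<^sup>2) \<le> sqrt ((u t $ 1)\<^sup>2)"
      by (intro real_sqrt_le_mono) simp
    ultimately show ?thesis
      using component_le_norm_cart[of "u t" 1] B[OF t] by simp
  qed
  ultimately have "integrable (lebesgue_on {0..t1}) (\<lambda>t. sqrt ((u t $ 1)\<^sup>2 - (u t $ 2)\<^sup>2))"
    by (intro finite_measure.integrable_const_bound[where B = B])
       (auto intro!: finite_measure_lebesgue_on AE_I2)
  then show ?thesis
    unfolding traj_length_def by (rule has_integral_integral_lebesgue_on) simp
qed

text \<open>The Legendre dual of the length: with the multipliers \<open>a\<close> and \<open>b\<close>, the integrand is the supremum of
\<open>sqrt (1 - w\<^sup>2) + h w\<close> over \<open>\<bar>w\<bar> \<le> 1\<close>, where \<open>h = a + b s\<^sup>2\<close>. Its gradient is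
\<open>(moment 0, moment 2)\<close>.\<close>

definition energy :: "real \<Rightarrow> real \<Rightarrow> real" where
  "energy a b = integral {0..1} (\<lambda>s. sqrt (1 + (a + b * s\<^sup>2)\<^sup>2))"

definition moment :: "nat \<Rightarrow> real \<Rightarrow> real \<Rightarrow> real" where
  "moment k a b = integral {0..1} (\<lambda>s. s ^ k * ((a + b * s\<^sup>2) / sqrt (1 + (a + b * s\<^sup>2)\<^sup>2)))"

definition opt_length :: "real \<Rightarrow> real \<Rightarrow> real" where
  "opt_length a b = integral {0..1} (\<lambda>s. 1 / sqrt (1 + (a + b * s\<^sup>2)\<^sup>2))"

lemma one_plus_square_pos: "0 < 1 + (x::real)\<^sup>2"
  by (simp add: add_pos_nonneg)

lemma one_plus_square_neq_0: "1 + (x::real)\<^sup>2 \<noteq> 0"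
  using one_plus_square_pos[of x] by simp

text \<open>The reversed Cauchy-Schwarz inequality in the Minkowski plane for the timelike vectors
\<open>(v, w)\<close> and \<open>(sqrt (1 + h\<^sup>2), h)\<close>, the latter of unit length. The difference of the squares of the
two sides is a perfect square.\<close>

lemma Lorentzian_Cauchy_Schwarz:
  fixes h v w :: real
  assumes "\<bar>w\<bar> \<le> v"
  shows "sqrt (v\<^sup>2 - w\<^sup>2) \<le> sqrt (1 + h\<^sup>2) * v - h * w"
proof (rule real_le_lsqrt)
  have "\<bar>h\<bar> \<le> sqrt (1 + h\<^sup>2)"
    by (rule real_le_rsqrt) simp
  then have "\<bar>h\<bar> * \<bar>w\<bar> \<le> sqrt (1 + h\<^sup>2) * v"
    using assms by (intro mult_mono) auto
  then show "0 \<le> sqrt (1 + h\<^sup>2) * v - h * w"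
    by (simp add: abs_mult[symmetric])
  have "(sqrt (1 + h\<^sup>2) * v - h * w)\<^sup>2 - (v\<^sup>2 - w\<^sup>2) = (h * v - sqrt (1 + h\<^sup>2) * w)\<^sup>2"
    using real_sqrt_pow2[of "1 + h\<^sup>2"] by (simp add: power2_eq_square algebra_simps)
  then show "v\<^sup>2 - w\<^sup>2 \<le> (sqrt (1 + h\<^sup>2) * v - h * w)\<^sup>2"
    by (metis diff_ge_0_iff_ge zero_le_power2)
qed

lemma admissible_cone:
  assumes "admissible t1 u q" "t \<in> {0..t1}"
  shows "\<bar>u t $ 2\<bar> \<le> u t $ 1"
  using assms by (auto simp: admissible_def U2_def)

text \<open>These bounds are \<open>sqrt (u1\<^sup>2 - u2\<^sup>2) \<le> u1\<close> integrated; they make the supremum in the distance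
finite and show that the distance tends to zero as the endpoint approaches the plane \<open>X = 0\<close>.\<close>

lemma length_le_abscissa:
  assumes "admissible t1 u q" "q 0 = 0"
  shows "0 \<le> traj_length t1 u" "traj_length t1 u \<le> q t1 $ 1" "0 \<le> q t1 $ 1"
proof -
  show "traj_length t1 u \<le> q t1 $ 1"
  proof (rule has_integral_le[OF admissible_length_has_integral admissible_integral_control_1])
    fix t assume "t \<in> {0..t1}"
    then show "sqrt ((u t $ 1)\<^sup>2 - (u t $ 2)\<^sup>2) \<le> u t $ 1"
      using Lorentzian_Cauchy_Schwarz[of "u t $ 2" "u t $ 1" 0] admissible_cone[OF assms(1)] by simp
  qed (use assms in auto)
  show "0 \<le> traj_length t1 u"
  proof (rule has_integral_nonneg[OF admissible_length_has_integral[OF assms(1)]])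
    fix t assume "t \<in> {0..t1}"
    then show "0 \<le> sqrt ((u t $ 1)\<^sup>2 - (u t $ 2)\<^sup>2)"
      using admissible_cone[OF assms(1), of t] by (simp add: abs_le_square_iff[symmetric])
  qed
  then show "0 \<le> q t1 $ 1"
    using \<open>traj_length t1 u \<le> q t1 $ 1\<close> by linarith
qed

text \<open>Weak duality: the pointwise inequality \<open>Lorentzian_Cauchy_Schwarz\<close> with \<open>h\<close> evaluated along the
trajectory, integrated. The right-hand side depends on the endpoint alone.\<close>

lemma length_le_dual:
  assumes adm: "admissible t1 u q" and q0: "q 0 = 0" and X: "X = q t1 $ 1" "X > 0"
  shows "traj_length t1 u \<le> X * energy a b - (a * q t1 $ 2 + 2 * b / X\<^sup>2 * q t1 $ 3)"
proof (rule has_integral_le[OF admissible_length_has_integral[OF adm]])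
  show "((\<lambda>t. sqrt (1 + (a + b * (q t $ 1 / X)\<^sup>2)\<^sup>2) * u t $ 1 - (a + b * (q t $ 1 / X)\<^sup>2) * u t $ 2)
      has_integral X * energy a b - (a * q t1 $ 2 + 2 * b / X\<^sup>2 * q t1 $ 3)) {0..t1}"
    unfolding energy_def
    by (intro has_integral_diff admissible_integral_second[OF adm q0]
      admissible_integral_first[OF adm q0 X, of "\<lambda>s. sqrt (1 + (a + b * s\<^sup>2)\<^sup>2)"] continuous_intros)
qed (use Lorentzian_Cauchy_Schwarz admissible_cone[OF adm] in blast)

text \<open>The right-hand side is the support function of the attainable endpoints with first coordinate \<open>X\<close>, in
normalised coordinates: in direction \<open>(a, b)\<close> the best control is \<open>u2 = sgn h * u1\<close>.\<close>

lemma endpoint_le_support: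
  assumes adm: "admissible t1 u q" and q0: "q 0 = 0" and X: "X = q t1 $ 1" "X > 0"
  shows "a * q t1 $ 2 + 2 * b / X\<^sup>2 * q t1 $ 3 \<le> X * integral {0..1} (\<lambda>s. \<bar>a + b * s\<^sup>2\<bar>)"
proof (rule has_integral_le[OF admissible_integral_second[OF adm q0]])
  show "((\<lambda>t. \<bar>a + b * (q t $ 1 / X)\<^sup>2\<bar> * u t $ 1)
      has_integral X * integral {0..1} (\<lambda>s. \<bar>a + b * s\<^sup>2\<bar>)) {0..t1}"
    by (intro admissible_integral_first[OF adm q0 X, of "\<lambda>s. \<bar>a + b * s\<^sup>2\<bar>"] continuous_intros)
  fix t assume t: "t \<in> {0..t1}"
  let ?h = "a + b * (q t $ 1 / X)\<^sup>2"
  have "?h * u t $ 2 \<le> \<bar>?h\<bar> * \<bar>u t $ 2\<bar>"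
    by (simp add: abs_mult[symmetric])
  also have "\<dots> \<le> \<bar>?h\<bar> * u t $ 1"
    using admissible_cone[OF adm t] by (intro mult_left_mono) auto
  finally show "?h * u t $ 2 \<le> \<bar>?h\<bar> * u t $ 1" .
qed

text \<open>The case of equality in weak duality: \<open>1 / sqrt (1 + h\<^sup>2) = sqrt (1 + h\<^sup>2) - h * (h / sqrt (1 + h\<^sup>2))\<close>.\<close>

lemma opt_length_eq_Legendre:
  "opt_length a b = energy a b - a * moment 0 a b - b * moment 2 a b"
proof -
  let ?h = "\<lambda>s. a + b * s\<^sup>2 :: real"
  have int: "(\<lambda>s. sqrt (1 + (?h s)\<^sup>2)) integrable_on {0..1}"
    "(\<lambda>s. s ^ k * (?h s / sqrt (1 + (?h s)\<^sup>2))) integrable_on {0..1}" for k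
    by (intro integrable_continuous_real continuous_intros; simp add: one_plus_square_neq_0)+
  have "((\<lambda>s. sqrt (1 + (?h s)\<^sup>2) - a * (s ^ 0 * (?h s / sqrt (1 + (?h s)\<^sup>2)))
        - b * (s ^ 2 * (?h s / sqrt (1 + (?h s)\<^sup>2))))
      has_integral energy a b - a * moment 0 a b - b * moment 2 a b) {0..1}"
    unfolding energy_def moment_def
    by (intro has_integral_diff has_integral_mult_right integrable_integral int)
  moreover have "sqrt (1 + (?h s)\<^sup>2) - a * (s ^ 0 * (?h s / sqrt (1 + (?h s)\<^sup>2)))
        - b * (s ^ 2 * (?h s / sqrt (1 + (?h s)\<^sup>2))) = 1 / sqrt (1 + (?h s)\<^sup>2)" for s
  proof -
    have "sqrt (1 + (?h s)\<^sup>2) * sqrt (1 + (?h s)\<^sup>2) = 1 + (?h s)\<^sup>2"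
      by simp
    moreover have "sqrt (1 + (?h s)\<^sup>2) \<noteq> 0"
      by (simp add: one_plus_square_neq_0)
    ultimately show ?thesis
      by (simp add: divide_simps) (simp add: algebra_simps power2_eq_square)
  qed
  ultimately show ?thesis
    unfolding opt_length_def by (simp add: integral_unique)
qed

text \<open>Equality in the Cauchy-Schwarz inequality forces \<open>u2 / u1 = h / sqrt (1 + h\<^sup>2)\<close>. With the first
coordinate as time, this control is continuous and the trajectory is its primitive; the endpoint is read
off from the substitution rule for admissible trajectories, applied to the curve itself.\<close>

lemma extremal_trajectory:
  assumes X: "X > 0"
  obtains u q where "admissible X u q" "q 0 = 0"
    "q X $ 1 = X" "q X $ 2 = X * moment 0 a b" "q X $ 3 = X ^ 3 / 2 * moment 2 a b"
    "traj_length X u = X * opt_length a b"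
proof -
  define h where "h s = a + b * s\<^sup>2" for s :: real
  define w where "w s = h s / sqrt (1 + (h s)\<^sup>2)" for s
  have cont_h: "continuous_on UNIV h"
    unfolding h_def by (intro continuous_intros)
  have cont_w: "continuous_on UNIV w"
    unfolding w_def by (intro continuous_intros cont_h) (simp add: one_plus_square_neq_0)
  have cont_wX: "continuous_on S (\<lambda>t. w (t / X))" for S
    using X by (intro continuous_on_UNIV_composeI[OF cont_w] continuous_intros) auto
  define v :: "real \<Rightarrow> real^3" where "v t = vector [1, w (t / X), w (t / X) * (t\<^sup>2 / 2)]" for t
  define q where "q t = integral {0..t} v" for t
  define u :: "real \<Rightarrow> real^2" where "u t = (\<chi> i. if i = 1 then 1 else w (t / X))" for t
  have u[simp]: "u t $ 1 = 1" "u t $ 2 = w (t / X)" for t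
    by (simp_all add: u_def)
  have u_eq: "u = (\<lambda>t. \<chi> i. (if i = 1 then (\<lambda>t. 1) else (\<lambda>t. w (t / X))) t)"
    by (simp add: fun_eq_iff vec_eq_iff u_def)
  have cont_u: "continuous_on S u" for S
    unfolding u_eq by (rule continuous_on_vec_lambda) (simp add: cont_wX)
  have cont_v: "continuous_on S v" for S
    unfolding v_def by (intro continuous_on_vector_3 continuous_intros cont_wX) simp_all
  have q_nth: "q t $ i = integral {0..t} (\<lambda>s. v s $ i)" for t i
    unfolding q_def using cont_v by (intro integral_component_eq_cart[symmetric] integrable_continuous_real)
  have q1: "q t $ 1 = t" if "t \<ge> 0" for t
    using that by (simp add: q_nth v_def)
  have q0: "q 0 = 0"
    by (simp add: q_def)
  have dq: "(q has_vector_derivative v t) (at t within {0..X})" if "t \<in> {0..X}" for t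
    unfolding q_def using that cont_v by (intro integral_has_vector_derivative)
  have "bounded (v ` {0..X})"
    by (intro compact_imp_bounded compact_continuous_image cont_v) simp
  then obtain B where B: "\<And>t. t \<in> {0..X} \<Longrightarrow> norm (v t) \<le> B"
    unfolding bounded_iff by blast
  have "0 \<le> B"
    using X by (intro order_trans[OF norm_ge_zero B[of 0]]) simp
  then have lip: "B-lipschitz_on {0..X} q"
    using B by (intro bounded_vector_derivative_imp_Lipschitz[OF _ _ dq]) auto
  have w_bound: "\<bar>w s\<bar> \<le> 1" for s
  proof -
    have "\<bar>h s\<bar> \<le> sqrt (1 + (h s)\<^sup>2)"
      by (rule real_le_rsqrt) simp
    moreover have "sqrt (1 + (h s)\<^sup>2) > 0"
      by (simp add: one_plus_square_pos)
    ultimately show ?thesis by (simp add: w_def)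
  qed
  have "admissible X u q"
    unfolding admissible_def
  proof (intro conjI ballI)
    show "u \<in> borel_measurable (lebesgue_on {0..X})"
      by (rule continuous_imp_measurable_on_sets_lebesgue[OF cont_u]) simp
    show "bounded (u ` {0..X})"
      by (intro compact_imp_bounded compact_continuous_image cont_u) simp
    show "AE t in lebesgue_on {0..X}. (q has_vector_derivative
        u t $ 1 *\<^sub>R X1 (q t) + u t $ 2 *\<^sub>R X2 (q t)) (at t within {0..X})"
    proof (rule AE_I2)
      fix t assume "t \<in> space (lebesgue_on {0..X})"
      then have t: "t \<in> {0..X}" by simp
      have "u t $ 1 *\<^sub>R X1 (q t) + u t $ 2 *\<^sub>R X2 (q t) = v t"
        using t by (simp add: vec_eq_iff forall_3 X1_def X2_def v_def q1)
      then show "(q has_vector_derivative u t $ 1 *\<^sub>R X1 (q t) + u t $ 2 *\<^sub>R X2 (q t)) (at t within {0..X})"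
        using dq[OF t] by simp
    qed
  qed (use X lip w_bound in \<open>auto simp: U2_def\<close>)
  moreover have qX: "q X $ 1 = X"
    using X by (simp add: q1)
  have int: "((\<lambda>t. \<phi> (t / X)) has_integral X * integral {0..1} \<phi>) {0..X}"
    if "continuous_on UNIV \<phi>" for \<phi> :: "real \<Rightarrow> real"
    using admissible_integral_first[OF \<open>admissible X u q\<close> q0 qX[symmetric] X that]
    by (rule has_integral_eq[rotated]) (simp add: q1)
  have "q X $ 2 = X * moment 0 a b"
  proof -
    have "q X $ 2 = integral {0..X} (\<lambda>t. w (t / X))"
      by (simp add: q_nth v_def)
    also have "\<dots> = X * integral {0..1} w"
      by (rule integral_unique[OF int[OF cont_w]])
    finally show ?thesis by (simp add: moment_def w_def[abs_def] h_def)
  qed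
  moreover have "q X $ 3 = X ^ 3 / 2 * moment 2 a b"
  proof -
    have "((\<lambda>t. X\<^sup>2 / 2 * ((t / X)\<^sup>2 * w (t / X))) has_integral
        X\<^sup>2 / 2 * (X * integral {0..1} (\<lambda>s. s\<^sup>2 * w s))) {0..X}"
      by (intro has_integral_mult_right int[of "\<lambda>s. s\<^sup>2 * w s"] continuous_intros cont_w)
    then have "((\<lambda>t. w (t / X) * (t\<^sup>2 / 2)) has_integral
        X\<^sup>2 / 2 * (X * integral {0..1} (\<lambda>s. s\<^sup>2 * w s))) {0..X}"
      by (rule has_integral_eq[rotated]) (use X in \<open>simp add: power_divide\<close>)
    from integral_unique[OF this] show ?thesis
      by (simp add: q_nth v_def moment_def w_def h_def power3_eq_cube power2_eq_square)
  qed
  moreover have "traj_length X u = X * opt_length a b"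
  proof -
    have "1 - (w s)\<^sup>2 = 1 / (1 + (h s)\<^sup>2)" for s
      using one_plus_square_neq_0[of "h s"] by (simp add: w_def power_divide field_simps)
    then have "sqrt ((u t $ 1)\<^sup>2 - (u t $ 2)\<^sup>2) = 1 / sqrt (1 + (h (t / X))\<^sup>2)" for t
      by (simp add: real_sqrt_divide)
    then have "((\<lambda>t. 1 / sqrt (1 + (h (t / X))\<^sup>2)) has_integral traj_length X u) {0..X}"
      using admissible_length_has_integral[OF \<open>admissible X u q\<close>] by simp
    moreover have "((\<lambda>t. 1 / sqrt (1 + (h (t / X))\<^sup>2)) has_integral X * opt_length a b) {0..X}"
      unfolding opt_length_def h_def[symmetric]
      by (intro int[of "\<lambda>s. 1 / sqrt (1 + (h s)\<^sup>2)"] continuous_intros cont_h)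
         (simp add: one_plus_square_neq_0)
    ultimately show ?thesis by (rule has_integral_unique)
  qed
  ultimately show thesis
    using that q0 qX by blast
qed

section \<open>Existence of multipliers by minimisation\<close>

lemma abs_le_sqrt_one_plus_square: "\<bar>x\<bar> \<le> sqrt (1 + x\<^sup>2)" for x :: real
  by (rule real_le_rsqrt) simp

lemma integrable_abs_quadratic: "(\<lambda>s. \<bar>a + b * s\<^sup>2\<bar>) integrable_on {0..1::real}"
  by (intro integrable_continuous_real continuous_intros)

lemma integrable_energy: "(\<lambda>s. sqrt (1 + (a + b * s\<^sup>2)\<^sup>2)) integrable_on {0..1::real}"
  by (intro integrable_continuous_real continuous_intros)

text \<open>The directional form of the gradient formula is all that the stationarity of a minimum requires.\<close>

lemma energy_has_derivative_along:
  "((\<lambda>\<tau>. energy (a + \<tau> * c) (b + \<tau> * d)) has_real_derivative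
      c * moment 0 a b + d * moment 2 a b) (at 0)"
proof -
  let ?h = "\<lambda>\<tau> s. (a + \<tau> * c) + (b + \<tau> * d) * s\<^sup>2 :: real"
  let ?f' = "\<lambda>\<tau> s. (c + d * s\<^sup>2) * (?h \<tau> s / sqrt (1 + (?h \<tau> s)\<^sup>2))"
  have "((\<lambda>\<tau>. integral (cbox 0 1) (\<lambda>s. sqrt (1 + (?h \<tau> s)\<^sup>2))) has_real_derivative
      integral (cbox 0 1) (?f' 0)) (at 0 within UNIV)"
  proof (rule leibniz_rule_field_derivative)
    fix \<tau> s :: real
    show "((\<lambda>\<tau>. sqrt (1 + (?h \<tau> s)\<^sup>2)) has_field_derivative ?f' \<tau> s) (at \<tau> within UNIV)"
      using one_plus_square_pos[of "?h \<tau> s"]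
      by (auto intro!: derivative_eq_intros simp: field_simps)
    show "(\<lambda>s. sqrt (1 + (?h \<tau> s)\<^sup>2)) integrable_on cbox 0 1"
      by (intro integrable_continuous continuous_intros)
    show "continuous_on (UNIV \<times> cbox 0 1) (\<lambda>(\<tau>, s). ?f' \<tau> s)"
      by (auto simp: case_prod_unfold one_plus_square_neq_0 intro!: continuous_intros)
  qed auto
  moreover have "(?f' 0 has_integral c * moment 0 a b + d * moment 2 a b) {0..1}"
  proof -
    have "(\<lambda>s. s ^ k * ((a + b * s\<^sup>2) / sqrt (1 + (a + b * s\<^sup>2)\<^sup>2))) integrable_on {0..1}" for k
      by (intro integrable_continuous_real continuous_intros; simp add: one_plus_square_neq_0)
    then have "((\<lambda>s. c * (s ^ 0 * ((a + b * s\<^sup>2) / sqrt (1 + (a + b * s\<^sup>2)\<^sup>2)))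
         + d * (s ^ 2 * ((a + b * s\<^sup>2) / sqrt (1 + (a + b * s\<^sup>2)\<^sup>2)))) has_integral
        c * moment 0 a b + d * moment 2 a b) {0..1}"
      unfolding moment_def
      by (intro has_integral_add has_integral_mult_right integrable_integral)
    then show ?thesis
      by (rule has_integral_eq[rotated]) (simp add: distrib_right add_divide_distrib mult.assoc)
  qed
  ultimately show ?thesis
    by (simp add: energy_def integral_unique)
qed

lemma continuous_on_support_functional:
  "continuous_on S (\<lambda>v. integral {0..1} (\<lambda>s. \<bar>fst v + snd v * s\<^sup>2\<bar>) - fst v * \<eta> - snd v * \<zeta> :: real)"
proof -
  have "continuous_on S (\<lambda>v. integral (cbox 0 1) (\<lambda>s. \<bar>fst v + snd v * s\<^sup>2\<bar> :: real))"
    by (rule integral_continuous_on_param) (auto simp: case_prod_unfold intro!: continuous_intros)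
  then show ?thesis
    by (auto intro!: continuous_intros)
qed

lemma continuous_on_dual_functional:
  "continuous_on S (\<lambda>v. energy (fst v) (snd v) - fst v * \<eta> - snd v * \<zeta>)"
proof -
  have "continuous_on S (\<lambda>v. integral (cbox 0 1) (\<lambda>s. sqrt (1 + (fst v + snd v * s\<^sup>2)\<^sup>2) :: real))"
    by (rule integral_continuous_on_param) (auto simp: case_prod_unfold intro!: continuous_intros)
  then show ?thesis
    unfolding energy_def by (auto intro!: continuous_intros)
qed

text \<open>The hypothesis says that \<open>(\<eta>, \<zeta>)\<close> lies strictly inside the convex set of moments of functions bounded by
\<open>1\<close>. Compactness of the unit circle turns the strict inequality into the bound
\<open>\<integral> \<bar>h\<bar> - a \<eta> - b \<zeta> \<ge> \<epsilon> * norm (a, b)\<close>, and since \<open>energy\<close> dominates \<open>\<integral> \<bar>h\<bar>\<close>, the function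
\<open>energy a b - a * \<eta> - b * \<zeta>\<close> has a minimum. Its gradient there is zero, which is the claim.\<close>

lemma moments_surjective:
  fixes \<eta> \<zeta> :: real
  assumes inside: "\<And>a b. (a, b) \<noteq> (0, 0) \<Longrightarrow>
      a * \<eta> + b * \<zeta> < integral {0..1} (\<lambda>s. \<bar>a + b * s\<^sup>2\<bar>)"
  obtains a b where "moment 0 a b = \<eta>" "moment 2 a b = \<zeta>"
proof -
  define n where "n v = integral {0..1} (\<lambda>s. \<bar>fst v + snd v * s\<^sup>2\<bar>) - fst v * \<eta> - snd v * \<zeta>" for v :: "real \<times> real"
  define F where "F v = energy (fst v) (snd v) - fst v * \<eta> - snd v * \<zeta>" for v :: "real \<times> real"
  have "sphere (0 :: real \<times> real) 1 \<noteq> {}"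
    by (auto simp: dist_norm intro!: exI[of _ 1] exI[of _ 0])
  moreover have "continuous_on (sphere 0 1) n"
    unfolding n_def by (rule continuous_on_support_functional)
  \<comment> \<open>The least value \<open>\<epsilon>\<close> on the unit circle is positive, and homogeneity spreads it to the plane.\<close>
  ultimately obtain v0 where v0: "v0 \<in> sphere 0 1" "\<And>v. v \<in> sphere 0 1 \<Longrightarrow> n v0 \<le> n v"
    using continuous_attains_inf[of "sphere 0 1" n] by auto
  define \<epsilon> where "\<epsilon> = n v0"
  have "v0 \<noteq> (0, 0)"
    using v0(1) by auto
  then have \<epsilon>: "\<epsilon> > 0"
    using inside[of "fst v0" "snd v0"] by (cases v0) (simp add: \<epsilon>_def n_def)
  have n_homogeneous: "n (c *\<^sub>R v) = c * n v" if "c \<ge> 0" for c v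
  proof -
    have "(\<lambda>s. \<bar>fst (c *\<^sub>R v) + snd (c *\<^sub>R v) * s\<^sup>2\<bar>) = (\<lambda>s. c * \<bar>fst v + snd v * s\<^sup>2\<bar>)"
      using that by (simp add: fun_eq_iff abs_mult[of c, simplified] mult.assoc distrib_left[symmetric])
    then show ?thesis
      unfolding n_def by (simp add: right_diff_distrib mult.assoc)
  qed
  have n_ge: "n v \<ge> \<epsilon> * norm v" for v
  proof (cases "v = 0")
    case False
    have "\<epsilon> \<le> n ((1 / norm v) *\<^sub>R v)"
      unfolding \<epsilon>_def using False by (intro v0(2)) simp
    also have "\<dots> = n v / norm v"
      by (subst n_homogeneous) auto
    finally show ?thesis
      using False by (simp add: pos_le_divide_eq)
  qed (simp add: n_def)
  have F_ge: "F v \<ge> n v" for v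
    unfolding F_def n_def energy_def
    using integral_le[OF integrable_abs_quadratic integrable_energy abs_le_sqrt_one_plus_square, of "fst v" "snd v"]
    by simp
  have F_0: "F 0 = 1"
    by (simp add: F_def energy_def)
  have "continuous_on (cball 0 (1 / \<epsilon>)) F"
    unfolding F_def by (rule continuous_on_dual_functional)
  moreover have "cball (0 :: real \<times> real) (1 / \<epsilon>) \<noteq> {}"
    using \<epsilon> by simp
  ultimately obtain m where m: "\<And>v. v \<in> cball 0 (1 / \<epsilon>) \<Longrightarrow> F m \<le> F v"
    using continuous_attains_inf[OF compact_cball] by metis
  \<comment> \<open>Outside the disc of radius \<open>1 / \<epsilon>\<close> the value exceeds \<open>F 0 = 1\<close>.\<close>
  have min: "F m \<le> F v" for v
  proof (cases "norm v \<le> 1 / \<epsilon>")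
    case False
    then have "1 < \<epsilon> * norm v"
      using \<epsilon> by (simp add: field_simps)
    moreover have "F m \<le> 1"
      using m[of 0] \<epsilon> F_0 by simp
    ultimately show ?thesis
      using n_ge[of v] F_ge[of v] by linarith
  qed (simp add: m)
  obtain a b where ab: "m = (a, b)"
    by (cases m)
  have stationary: "c * moment 0 a b + d * moment 2 a b - c * \<eta> - d * \<zeta> = 0" for c d
  proof (rule DERIV_local_min)
    show "((\<lambda>\<tau>. F (a + \<tau> * c, b + \<tau> * d)) has_real_derivative
        c * moment 0 a b + d * moment 2 a b - c * \<eta> - d * \<zeta>) (at 0)"
      unfolding F_def fst_conv snd_conv
      by (auto intro!: derivative_eq_intros energy_has_derivative_along)
    show "\<forall>\<tau>. \<bar>0 - \<tau>\<bar> < 1 \<longrightarrow> F (a + 0 * c, b + 0 * d) \<le> F (a + \<tau> * c, b + \<tau> * d)"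
      using min ab by simp
  qed simp
  show thesis
    using that stationary[of 1 0] stationary[of 0 1] by simp
qed

lemma sqrt_one_plus_square_minus_le:
  fixes x :: real
  assumes "x > 0"
  shows "sqrt (1 + x\<^sup>2) - x \<le> 1 / x"
proof -
  have "sqrt (1 + x\<^sup>2) \<le> x + 1 / x"
    using assms by (intro real_le_lsqrt) (auto simp: power2_eq_square field_simps)
  then show ?thesis by simp
qed

text \<open>The integrand \<open>sqrt (1 + (n h)\<^sup>2) - \<bar>n h\<bar>\<close> stays in \<open>[0, 1]\<close> and tends to zero where \<open>h \<noteq> 0\<close>, which
on \<open>[0, 1]\<close> excludes at most one point. So in a supporting direction the dual bound becomes sharp at
infinity, with value zero.\<close>

lemma energy_minus_support_tendsto_0:
  fixes a b :: real
  assumes "(a, b) \<noteq> (0, 0)"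
  shows "(\<lambda>n. energy (real n * a) (real n * b) - real n * integral {0..1} (\<lambda>s. \<bar>a + b * s\<^sup>2\<bar>)) \<longlonglongrightarrow> 0"
proof -
  let ?h = "\<lambda>s. a + b * s\<^sup>2"
  define f where "f n s = sqrt (1 + (real n * ?h s)\<^sup>2) - \<bar>real n * ?h s\<bar>" for n s
  define g where "g s = (if ?h s = 0 then 1 else 0 :: real)" for s
  have f_int: "(f n has_integral energy (real n * a) (real n * b)
      - real n * integral {0..1} (\<lambda>s. \<bar>?h s\<bar>)) {0..1}" for n
  proof -
    have "((\<lambda>s. sqrt (1 + (real n * a + real n * b * s\<^sup>2)\<^sup>2) - real n * \<bar>?h s\<bar>) has_integral
        energy (real n * a) (real n * b) - real n * integral {0..1} (\<lambda>s. \<bar>?h s\<bar>)) {0..1}"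
      unfolding energy_def
      by (intro has_integral_diff has_integral_mult_right integrable_integral
          integrable_energy integrable_abs_quadratic)
    then show ?thesis
      by (rule has_integral_eq[rotated]) (simp add: f_def abs_mult, simp add: algebra_simps)
  qed
  have f_bound: "norm (f n s) \<le> 1" for n s
  proof -
    have "sqrt (1 + (real n * ?h s)\<^sup>2) \<le> 1 + \<bar>real n * ?h s\<bar>"
      by (intro real_le_lsqrt) (auto simp: power2_eq_square algebra_simps)
    then show ?thesis
      using abs_le_sqrt_one_plus_square[of "real n * ?h s"] unfolding f_def real_norm_def by linarith
  qed
  have f_lim: "(\<lambda>n. f n s) \<longlonglongrightarrow> g s" for s
  proof (cases "?h s = 0")
    case True
    then show ?thesis by (simp add: f_def g_def)
  next
    case False
    have "(\<lambda>n. f n s) \<longlonglongrightarrow> 0"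
    proof (rule tendsto_sandwich)
      show "\<forall>\<^sub>F n in sequentially. 0 \<le> f n s"
        using abs_le_sqrt_one_plus_square by (simp add: f_def)
      show "\<forall>\<^sub>F n in sequentially. f n s \<le> (1 / \<bar>?h s\<bar>) * (1 / real n)"
        using eventually_gt_at_top[of 0]
      proof eventually_elim
        case (elim n)
        then have "\<bar>real n * ?h s\<bar> > 0"
          using False by simp
        from sqrt_one_plus_square_minus_le[OF this] show ?case
          by (simp add: f_def abs_mult power_mult_distrib mult.commute)
      qed
      show "(\<lambda>n. (1 / \<bar>?h s\<bar>) * (1 / real n)) \<longlonglongrightarrow> 0"
        by (intro tendsto_mult_right_zero lim_1_over_n)
    qed auto
    then show ?thesis using False by (simp add: g_def)
  qed
  have "(\<lambda>n. integral {0..1} (f n)) \<longlonglongrightarrow> integral {0..1} g"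
    using f_int f_bound f_lim
    by (intro dominated_convergence(2)[where h = "\<lambda>_. 1"]) auto
  moreover have "(g has_integral 0) {0..1}"
  proof (rule has_integral_spike[where f = "\<lambda>_. 0" and S = "{sqrt (- a / b)}"])
    fix s assume s: "s \<in> {0..1} - {sqrt (- a / b)}"
    have "?h s \<noteq> 0"
    proof
      assume h0: "?h s = 0"
      then have "b \<noteq> 0" using assms by auto
      then have "s\<^sup>2 = - a / b" using h0 by (simp add: field_simps)
      then have "s = sqrt (- a / b)" using s by (metis DiffD1 atLeastAtMost_iff real_sqrt_unique)
      then show False using s by simp
    qed
    then show "g s = 0" by (simp add: g_def)
  qed auto
  ultimately show ?thesis
    by (simp add: integral_unique[OF f_int] integral_unique[of g])
qed

section \<open>Complexification of the moment map\<close>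

text \<open>On this strip \<open>1 + h\<^sup>2\<close> has positive real part, so the principal branch of its square root is
holomorphic there.\<close>

definition strip :: "complex set" where
  "strip = {h. \<bar>Im h\<bar> < 1}"

lemma one_plus_square_strip:
  assumes "h \<in> strip"
  shows "0 < Re (1 + h\<^sup>2)" "1 + h\<^sup>2 \<notin> \<real>\<^sub>\<le>\<^sub>0" "csqrt (1 + h\<^sup>2) \<noteq> 0"
proof -
  have "(Im h)\<^sup>2 < 1"
    using assms by (simp add: strip_def abs_square_less_1)
  then show *: "0 < Re (1 + h\<^sup>2)"
    using zero_le_power2[of "Re h"] unfolding Re_power2 plus_complex.sel one_complex.sel by linarith
  then show "1 + h\<^sup>2 \<notin> \<real>\<^sub>\<le>\<^sub>0"
    by (auto simp: complex_nonpos_Reals_iff)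
  show "csqrt (1 + h\<^sup>2) \<noteq> 0"
    using * by (metis csqrt_eq_0 less_irrefl zero_complex.sel(1))
qed

lemma csqrt_one_plus_square_of_real:
  "csqrt (1 + (complex_of_real x)\<^sup>2) = of_real (sqrt (1 + x\<^sup>2))"
  using csqrt_of_real[of "1 + x\<^sup>2"] one_plus_square_pos[of x] by simp

text \<open>Velocity and lapse are the integrands of the moments and of the optimal length as functions of a complex
\<open>h\<close>; the primed constants are their derivatives.\<close>

definition velocity :: "complex \<Rightarrow> complex" where
  "velocity h = h / csqrt (1 + h\<^sup>2)"

definition velocity' :: "complex \<Rightarrow> complex" where
  "velocity' h = 1 / csqrt (1 + h\<^sup>2) ^ 3"

definition lapse :: "complex \<Rightarrow> complex" where
  "lapse h = 1 / csqrt (1 + h\<^sup>2)"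

definition lapse' :: "complex \<Rightarrow> complex" where
  "lapse' h = - h / csqrt (1 + h\<^sup>2) ^ 3"

lemma DERIV_velocity:
  assumes "h \<in> strip"
  shows "(velocity has_field_derivative velocity' h) (at h)"
proof -
  let ?s = "csqrt (1 + h\<^sup>2)"
  note s = one_plus_square_strip[OF assms]
  have "?s * ?s = 1 + h\<^sup>2"
    by (metis power2_csqrt power2_eq_square)
  then have "(?s - h * (2 * h / (2 * ?s))) / (?s * ?s) = 1 / ?s ^ 3"
    using s(3) by (simp add: divide_simps power3_eq_cube) (simp add: algebra_simps power2_eq_square)
  moreover have "((\<lambda>h. h / csqrt (1 + h\<^sup>2)) has_field_derivative
      (1 * ?s - h * (2 * h / (2 * ?s))) / (?s * ?s)) (at h)"
    using s by (auto intro!: derivative_eq_intros)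
  ultimately show ?thesis
    by (simp add: velocity_def[abs_def] velocity'_def)
qed

lemma DERIV_lapse:
  assumes "h \<in> strip"
  shows "(lapse has_field_derivative lapse' h) (at h)"
proof -
  let ?s = "csqrt (1 + h\<^sup>2)"
  note s = one_plus_square_strip[OF assms]
  have "((\<lambda>h. 1 / csqrt (1 + h\<^sup>2)) has_field_derivative
      (0 * ?s - 1 * (2 * h / (2 * ?s))) / (?s * ?s)) (at h)"
    using s by (auto intro!: derivative_eq_intros)
  then show ?thesis
    using s(3) by (simp add: lapse_def[abs_def] lapse'_def power3_eq_cube mult.assoc)
qed

lemma continuous_on_csqrt_strip: "continuous_on strip (\<lambda>h. csqrt (1 + h\<^sup>2))"
proof (rule continuous_at_imp_continuous_on, rule ballI)
  fix h assume "h \<in> strip"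
  then have "((\<lambda>h. csqrt (1 + h\<^sup>2)) has_field_derivative (0 + 2 * h) / (2 * csqrt (1 + h\<^sup>2))) (at h)"
    using one_plus_square_strip[of h] by (auto intro!: derivative_eq_intros)
  then show "isCont (\<lambda>h. csqrt (1 + h\<^sup>2)) h"
    by (rule DERIV_isCont)
qed

text \<open>For multipliers in this convex neighbourhood of the real plane, \<open>a + b s\<^sup>2\<close> stays in the strip for every
\<open>s\<close> in \<open>[0, 1]\<close>.\<close>

definition tube :: "(complex \<times> complex) set" where
  "tube = {v. \<bar>Im (fst v)\<bar> + \<bar>Im (snd v)\<bar> < 1}"

lemma open_tube: "open tube"
  unfolding tube_def by (intro open_Collect_less continuous_intros)

lemma convex_tube: "convex tube"
proof (rule convexI)
  fix v w :: "complex \<times> complex" and x y :: real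
  assume v: "v \<in> tube" and w: "w \<in> tube" and xy: "0 \<le> x" "0 \<le> y" "x + y = 1"
  have tri: "\<bar>x * p + y * q\<bar> \<le> x * \<bar>p\<bar> + y * \<bar>q\<bar>" for p q :: real
    using abs_triangle_ineq[of "x * p" "y * q"] xy by (simp add: abs_mult)
  let ?n = "\<lambda>v :: complex \<times> complex. \<bar>Im (fst v)\<bar> + \<bar>Im (snd v)\<bar>"
  have "?n (x *\<^sub>R v + y *\<^sub>R w) \<le> x * ?n v + y * ?n w"
    using tri[of "Im (fst v)" "Im (fst w)"] tri[of "Im (snd v)" "Im (snd w)"] by (simp add: algebra_simps)
  also have "\<dots> < 1"
    using v w xy unfolding tube_def mem_Collect_eq by (rule convex_bound_lt)
  finally show "x *\<^sub>R v + y *\<^sub>R w \<in> tube"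
    by (simp add: tube_def)
qed

lemma tube_strip:
  assumes "v \<in> tube" "s \<in> {0..1}"
  shows "fst v + snd v * (complex_of_real s)\<^sup>2 \<in> strip"
proof -
  have "s\<^sup>2 \<le> 1"
    using assms(2) by (simp add: power_le_one)
  then have "\<bar>Im (snd v)\<bar> * s\<^sup>2 \<le> \<bar>Im (snd v)\<bar>"
    by (intro mult_left_le) auto
  moreover have "\<bar>Im (fst v) + Im (snd v) * s\<^sup>2\<bar> \<le> \<bar>Im (fst v)\<bar> + \<bar>Im (snd v)\<bar> * s\<^sup>2"
    using abs_triangle_ineq[of "Im (fst v)" "Im (snd v) * s\<^sup>2"] by (simp add: abs_mult)
  moreover have "Im (fst v + snd v * (complex_of_real s)\<^sup>2) = Im (fst v) + Im (snd v) * s\<^sup>2"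
    by (simp flip: of_real_power)
  ultimately show ?thesis
    using assms(1) by (simp add: tube_def strip_def)
qed

definition blinfun_row :: "complex \<Rightarrow> complex \<Rightarrow> (complex \<times> complex) \<Rightarrow>\<^sub>L complex" where
  "blinfun_row p q = (blinfun_mult_right p o\<^sub>L fst_blinfun) + (blinfun_mult_right q o\<^sub>L snd_blinfun)"

lemma blinfun_row_apply [simp]: "blinfun_row p q v = p * fst v + q * snd v"
  by (simp add: blinfun_row_def blinfun.add_left)

lemma continuous_on_blinfun_row:
  assumes "continuous_on S p" "continuous_on S q"
  shows "continuous_on S (\<lambda>x. blinfun_row (p x) (q x))"
  unfolding blinfun_row_def
  by (intro continuous_intros bounded_bilinear.continuous_on[OF bounded_bilinear_blinfun_compose]
      bounded_linear.continuous_on[OF bounded_linear_blinfun_mult_right] assms)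

definition quad_integral :: "(complex \<Rightarrow> complex) \<Rightarrow> nat \<Rightarrow> complex \<times> complex \<Rightarrow> complex" where
  "quad_integral f k v =
     integral {0..1} (\<lambda>s. complex_of_real s ^ k * f (fst v + snd v * (complex_of_real s)\<^sup>2))"

lemma continuous_on_quad_integrand:
  assumes "continuous_on strip f"
  shows "continuous_on (tube \<times> cbox 0 1)
    (\<lambda>x. complex_of_real (snd x) ^ k * f (fst (fst x) + snd (fst x) * (complex_of_real (snd x))\<^sup>2))"
  using tube_strip by (intro continuous_intros continuous_on_compose2[OF assms]) auto

lemma integrable_quad_integrand:
  assumes "continuous_on strip f" "v \<in> tube"
  shows "(\<lambda>s. complex_of_real s ^ k * f (fst v + snd v * (complex_of_real s)\<^sup>2)) integrable_on {0..1}"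
  using tube_strip[OF assms(2)]
  by (intro integrable_continuous_real continuous_intros continuous_on_compose2[OF assms(1)]) auto

lemma continuous_on_quad_integral:
  assumes "continuous_on strip f"
  shows "continuous_on tube (quad_integral f k)"
proof -
  have "continuous_on tube (\<lambda>v. integral (cbox 0 1)
      (\<lambda>s. complex_of_real s ^ k * f (fst v + snd v * (complex_of_real s)\<^sup>2)))"
    using continuous_on_quad_integrand[OF assms]
    by (intro integral_continuous_on_param) (simp add: case_prod_unfold)
  then show ?thesis
    by (simp add: quad_integral_def[abs_def])
qed

text \<open>Differentiation under the integral sign. The derivative is complex linear, which is what makes the
function holomorphic in each variable, and the factor \<open>s\<^sup>2\<close> of \<open>b\<close> raises the weight by two.\<close>

lemma quad_integral_has_derivative:
  assumes deriv: "\<And>h. h \<in> strip \<Longrightarrow> (f has_field_derivative f' h) (at h)"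
    and cont: "continuous_on strip f'" and v: "v \<in> tube"
  shows "(quad_integral f k has_derivative
      (\<lambda>d. quad_integral f' k v * fst d + quad_integral f' (k + 2) v * snd d)) (at v)"
proof -
  let ?h = "\<lambda>v s. fst v + snd v * (complex_of_real s)\<^sup>2"
  define D where "D v s = blinfun_row (of_real s ^ k * f' (?h v s)) (of_real s ^ (k + 2) * f' (?h v s))" for v s
  have contf: "continuous_on strip f"
    using deriv by (meson DERIV_isCont continuous_at_imp_continuous_on)
  have contD: "continuous_on (tube \<times> cbox 0 1) (\<lambda>(v, s). D v s)"
    unfolding D_def case_prod_unfold
    by (intro continuous_on_blinfun_row continuous_on_quad_integrand cont)
  have "((\<lambda>v. integral (cbox 0 1) (\<lambda>s. of_real s ^ k * f (?h v s))) has_derivative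
      integral (cbox 0 1) (D v)) (at v within tube)"
  proof (rule leibniz_rule[OF _ _ contD v convex_tube])
    fix v and s :: real assume v: "v \<in> tube" and s: "s \<in> cbox 0 1"
    have "?h v s \<in> strip"
      using v s by (intro tube_strip) auto
    note f = deriv[OF this, unfolded has_field_derivative_def]
    have "((\<lambda>v. ?h v s) has_derivative (\<lambda>d. fst d + snd d * (of_real s)\<^sup>2)) (at v within tube)"
      by (auto intro!: derivative_eq_intros)
    from has_derivative_mult_right[OF has_derivative_compose[OF this f], of "of_real s ^ k"]
    show "((\<lambda>v. of_real s ^ k * f (?h v s)) has_derivative D v s) (at v within tube)"
      by (rule has_derivative_eq_rhs) (simp add: D_def fun_eq_iff algebra_simps power_add power2_eq_square)
  next
    fix v assume v: "v \<in> tube"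
    show "(\<lambda>s. of_real s ^ k * f (?h v s)) integrable_on cbox 0 1"
      using integrable_quad_integrand[OF contf v] by simp
  qed
  moreover have "blinfun_apply (integral (cbox 0 1) (D v)) =
      (\<lambda>d. quad_integral f' k v * fst d + quad_integral f' (k + 2) v * snd d)"
  proof
    fix d
    have "continuous_on (cbox 0 1) (D v)"
      using continuous_on_compose2[OF contD, of "cbox 0 1" "\<lambda>s. (v, s)"] v
      by (force intro!: continuous_intros)
    then have "D v integrable_on cbox 0 1"
      by (rule integrable_continuous)
    then have "blinfun_apply (integral (cbox 0 1) (D v)) d = integral (cbox 0 1) (\<lambda>s. D v s d)"
      by (rule blinfun_apply_integral)
    also have "((\<lambda>s. D v s d) has_integral
        quad_integral f' k v * fst d + quad_integral f' (k + 2) v * snd d) {0..1}"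
      unfolding D_def blinfun_row_apply quad_integral_def
      by (intro has_integral_add has_integral_mult_left integrable_integral integrable_quad_integrand cont v)
    then have "integral (cbox 0 1) (\<lambda>s. D v s d) = quad_integral f' k v * fst d + quad_integral f' (k + 2) v * snd d"
      by (simp add: integral_unique)
    finally show "blinfun_apply (integral (cbox 0 1) (D v)) d =
        quad_integral f' k v * fst d + quad_integral f' (k + 2) v * snd d" .
  qed
  ultimately show ?thesis
    using at_within_open[OF v open_tube] by (simp add: quad_integral_def[abs_def])
qed

lemma quad_integral_of_real:
  assumes "\<And>x. f (complex_of_real x) = of_real (g x)" and "continuous_on UNIV g"
  shows "quad_integral f k (of_real a, of_real b) = of_real (integral {0..1} (\<lambda>s. s ^ k * g (a + b * s\<^sup>2)))"
proof -
  have "(\<lambda>s. s ^ k * g (a + b * s\<^sup>2)) integrable_on {0..1}"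
    by (intro integrable_continuous_real continuous_intros continuous_on_UNIV_composeI[OF assms(2)])
  from has_integral_linear[OF integrable_integral[OF this] bounded_linear_of_real[where 'a = complex]]
  have "((\<lambda>s. complex_of_real (s ^ k * g (a + b * s\<^sup>2))) has_integral
      of_real (integral {0..1} (\<lambda>s. s ^ k * g (a + b * s\<^sup>2)))) {0..1}"
    by (simp add: o_def)
  moreover have "complex_of_real (s ^ k * g (a + b * s\<^sup>2)) =
      of_real s ^ k * f (fst (complex_of_real a, complex_of_real b) + snd (complex_of_real a, complex_of_real b) * (complex_of_real s)\<^sup>2)" for s
    using assms(1)[of "a + b * s\<^sup>2"] by simp
  ultimately show ?thesis
    unfolding quad_integral_def by (simp only: integral_unique)
qed

text \<open>Needed to recognise the local inverse of the moment map as real on real arguments.\<close>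

lemma quad_integral_cnj:
  assumes f: "\<And>h. h \<in> strip \<Longrightarrow> f (cnj h) = cnj (f h)" and "continuous_on strip f" and v: "v \<in> tube"
  shows "quad_integral f k (cnj (fst v), cnj (snd v)) = cnj (quad_integral f k v)"
proof -
  let ?h = "\<lambda>s. fst v + snd v * (complex_of_real s)\<^sup>2"
  have "((\<lambda>s. cnj (of_real s ^ k * f (?h s))) has_integral cnj (quad_integral f k v)) {0..1}"
    unfolding quad_integral_def
    using has_integral_linear[OF integrable_integral[OF integrable_quad_integrand[OF assms(2) v]] bounded_linear_cnj]
    by (simp add: o_def)
  moreover have "cnj (of_real s ^ k * f (?h s)) =
      of_real s ^ k * f (cnj (fst v) + cnj (snd v) * (complex_of_real s)\<^sup>2)" if "s \<in> {0..1}" for s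
    using f[OF tube_strip[OF v that]] by simp
  ultimately have "((\<lambda>s. of_real s ^ k * f (cnj (fst v) + cnj (snd v) * (complex_of_real s)\<^sup>2))
      has_integral cnj (quad_integral f k v)) {0..1}"
    by (metis (no_types, lifting) has_integral_cong)
  then show ?thesis
    unfolding quad_integral_def by (simp add: integral_unique)
qed

section \<open>Holomorphic dependence on the moments\<close>

definition complex_differentiable_on_2 ::
  "(complex \<times> complex \<Rightarrow> complex) \<Rightarrow> (complex \<times> complex) set \<Rightarrow> bool" where
  "complex_differentiable_on_2 F V \<longleftrightarrow>
     (\<forall>w\<in>V. \<exists>p q. (F has_derivative (\<lambda>d. p * fst d + q * snd d)) (at w))"

definition blinfun_mat2 ::
  "complex \<Rightarrow> complex \<Rightarrow> complex \<Rightarrow> complex \<Rightarrow> (complex \<times> complex) \<Rightarrow>\<^sub>L (complex \<times> complex)" where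
  "blinfun_mat2 p q r s =
     (Blinfun (\<lambda>x. (x, 0)) o\<^sub>L blinfun_row p q) + (Blinfun (\<lambda>x. (0, x)) o\<^sub>L blinfun_row r s)"

lemma blinfun_mat2_apply [simp]:
  "blinfun_mat2 p q r s v = (p * fst v + q * snd v, r * fst v + s * snd v)"
proof -
  have "bounded_linear (\<lambda>x :: complex. (x, 0 :: complex))" "bounded_linear (\<lambda>x :: complex. (0 :: complex, x))"
    by (intro bounded_linear_intros)+
  then show ?thesis
    by (simp add: blinfun_mat2_def blinfun.add_left bounded_linear_Blinfun_apply)
qed

lemma continuous_on_blinfun_mat2:
  assumes "continuous_on S p" "continuous_on S q" "continuous_on S r" "continuous_on S s"
  shows "continuous_on S (\<lambda>x. blinfun_mat2 (p x) (q x) (r x) (s x))"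
  unfolding blinfun_mat2_def
  by (intro continuous_intros bounded_bilinear.continuous_on[OF bounded_bilinear_blinfun_compose]
      continuous_on_blinfun_row assms)

text \<open>The inverse function theorem for a Euclidean space only provides a real-linear derivative of the inverse; this
shows that it is again complex linear.\<close>

lemma inverse_of_blinfun_mat2_complex_linear:
  assumes "bij (blinfun_apply (blinfun_mat2 p q r s))"
  obtains p' q' r' s' where
    "inv (blinfun_apply (blinfun_mat2 p q r s)) = (\<lambda>d. (p' * fst d + q' * snd d, r' * fst d + s' * snd d))"
proof -
  let ?L = "blinfun_apply (blinfun_mat2 p q r s)"
  obtain p' r' where 1: "inv ?L (1, 0) = (p', r')" by (cases "inv ?L (1, 0)")
  obtain q' s' where 2: "inv ?L (0, 1) = (q', s')" by (cases "inv ?L (0, 1)")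
  have L: "?L (p', r') = (1, 0)" "?L (q', s') = (0, 1)"
    using 1 2 surj_f_inv_f[OF bij_is_surj[OF assms]] by metis+
  have "inv ?L d = (p' * fst d + q' * snd d, r' * fst d + s' * snd d)" for d
  proof (rule inv_f_eq[OF bij_is_inj[OF assms]])
    have "?L (p' * x + q' * y, r' * x + s' * y) = (x, y)" for x y
    proof -
      have "p * p' + q * r' = 1" "r * p' + s * r' = 0" "p * q' + q * s' = 0" "r * q' + s * s' = 1"
        using L by auto
      moreover have "p * (p' * x + q' * y) + q * (r' * x + s' * y) = (p * p' + q * r') * x + (p * q' + q * s') * y"
        "r * (p' * x + q' * y) + s * (r' * x + s' * y) = (r * p' + s * r') * x + (r * q' + s * s') * y"
        by (simp_all add: algebra_simps)
      ultimately show ?thesis by simp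
    qed
    then show "?L (p' * fst d + q' * snd d, r' * fst d + s' * snd d) = d"
      by (cases d) (simp del: blinfun_mat2_apply)
  qed
  then show thesis
    using that by blast
qed

text \<open>Strict Cauchy-Schwarz for \<open>1\<close> and \<open>s\<^sup>2\<close> in the weighted inner product: the quadratic form
\<open>\<integral> \<rho> (x - y s\<^sup>2)\<^sup>2\<close> is positive definite, because a polynomial \<open>x - y s\<^sup>2\<close> that vanishes on
\<open>[0, 1]\<close> is zero.\<close>

lemma weighted_moment_determinant_pos:
  fixes \<rho> :: "real \<Rightarrow> real"
  assumes cont: "continuous_on UNIV \<rho>" and pos: "\<And>s. \<rho> s > 0"
  defines "m \<equiv> \<lambda>k. integral {0..1} (\<lambda>s. s ^ k * \<rho> s)"
  shows "m 0 * m 4 - m 2 * m 2 > 0"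
proof -
  have int: "(\<lambda>s. s ^ k * \<rho> s) integrable_on {0..1}" for k
    by (intro integrable_continuous_real continuous_intros continuous_on_subset[OF cont]) auto
  have square: "((\<lambda>s. \<rho> s * (x - y * s\<^sup>2)\<^sup>2) has_integral x\<^sup>2 * m 0 - 2 * x * y * m 2 + y\<^sup>2 * m 4) {0..1}" for x y
  proof -
    have "((\<lambda>s. x\<^sup>2 * (s ^ 0 * \<rho> s) - 2 * x * y * (s ^ 2 * \<rho> s) + y\<^sup>2 * (s ^ 4 * \<rho> s))
        has_integral x\<^sup>2 * m 0 - 2 * x * y * m 2 + y\<^sup>2 * m 4) {0..1}"
      unfolding m_def
      by (intro has_integral_add has_integral_diff has_integral_mult_right integrable_integral int)
    then show ?thesis
      by (rule has_integral_eq[rotated]) (simp add: power2_eq_square power4_eq_xxxx algebra_simps)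
  qed
  have square_pos: "x\<^sup>2 * m 0 - 2 * x * y * m 2 + y\<^sup>2 * m 4 > 0" if "(x, y) \<noteq> (0, 0)" for x y
  proof (rule ccontr)
    assume "\<not> ?thesis"
    moreover have "x\<^sup>2 * m 0 - 2 * x * y * m 2 + y\<^sup>2 * m 4 \<ge> 0"
      by (rule has_integral_nonneg[OF square]) (simp add: pos less_imp_le)
    ultimately have "((\<lambda>s. \<rho> s * (x - y * s\<^sup>2)\<^sup>2) has_integral 0) (cbox 0 1)"
      using square[of x y] by simp
    then have zero: "\<rho> s * (x - y * s\<^sup>2)\<^sup>2 = 0" if "s \<in> cbox 0 1" for s
      using that pos
      by (intro has_integral_0_cbox_imp_0[of 0 1 "\<lambda>s. \<rho> s * (x - y * s\<^sup>2)\<^sup>2"]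
          continuous_intros continuous_on_subset[OF cont]) (auto simp: less_imp_le)
    from zero[of 0] zero[of 1] have "x = 0" "x = y"
      using pos[of 0] pos[of 1] by auto
    then show False using that by simp
  qed
  have m0: "m 0 > 0"
    using square_pos[of 1 0] by simp
  \<comment> \<open>The quadratic form at \<open>x = m 2\<close>, \<open>y = m 0\<close>, its minimiser up to scale.\<close>
  have "0 < m 0 * (m 0 * m 4 - m 2 * m 2)"
    using square_pos[of "m 2" "m 0"] m0 by (simp add: power2_eq_square algebra_simps)
  then show ?thesis
    using m0 by (simp add: zero_less_mult_iff)
qed

lemma real_point_in_tube: "(complex_of_real a, complex_of_real b) \<in> tube"
  by (simp add: tube_def)

definition moment_map :: "complex \<times> complex \<Rightarrow> complex \<times> complex" where
  "moment_map v = (quad_integral velocity 0 v, quad_integral velocity 2 v)"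

definition moment_jacobian :: "complex \<times> complex \<Rightarrow> (complex \<times> complex) \<Rightarrow>\<^sub>L (complex \<times> complex)" where
  "moment_jacobian v = blinfun_mat2 (quad_integral velocity' 0 v) (quad_integral velocity' 2 v)
                                    (quad_integral velocity' 2 v) (quad_integral velocity' 4 v)"

lemma continuous_on_strip_intros:
  "continuous_on strip velocity" "continuous_on strip velocity'" "continuous_on strip lapse" "continuous_on strip lapse'"
  unfolding velocity_def velocity'_def lapse_def lapse'_def
  using one_plus_square_strip(3) by (intro continuous_intros continuous_on_csqrt_strip; force)+

lemma moment_map_has_derivative:
  assumes "v \<in> tube"
  shows "(moment_map has_derivative blinfun_apply (moment_jacobian v)) (at v)"
proof -
  note deriv = quad_integral_has_derivative[OF DERIV_velocity continuous_on_strip_intros(2) assms]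
  have "2 + 2 = (4 :: nat)"
    by simp
  from has_derivative_Pair[OF deriv[of 0, unfolded add_0] deriv[of 2, unfolded this]]
  have "((\<lambda>v. (quad_integral velocity 0 v, quad_integral velocity 2 v)) has_derivative
      blinfun_apply (moment_jacobian v)) (at v)"
    by (rule has_derivative_eq_rhs) (simp_all add: moment_jacobian_def fun_eq_iff)
  then show ?thesis
    by (simp add: moment_map_def[abs_def])
qed

lemma moment_map_of_real:
  "moment_map (of_real a, of_real b) = (of_real (moment 0 a b), of_real (moment 2 a b))"
proof -
  have "quad_integral velocity k (of_real a, of_real b) = of_real (moment k a b)" for k
    unfolding moment_def
    by (rule quad_integral_of_real[where g = "\<lambda>x. x / sqrt (1 + x\<^sup>2)"])
       (auto simp: velocity_def csqrt_one_plus_square_of_real one_plus_square_neq_0 intro!: continuous_intros)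
  then show ?thesis by (simp add: moment_map_def)
qed

lemma lapse_integral_of_real:
  "quad_integral lapse 0 (of_real a, of_real b) = of_real (opt_length a b)"
  using quad_integral_of_real[where g = "\<lambda>x. 1 / sqrt (1 + x\<^sup>2)" and f = lapse and k = 0]
  by (simp add: lapse_def csqrt_one_plus_square_of_real opt_length_def one_plus_square_neq_0 continuous_intros)

lemma moment_map_cnj:
  assumes "v \<in> tube"
  shows "moment_map (cnj (fst v), cnj (snd v)) = (cnj (fst (moment_map v)), cnj (snd (moment_map v)))"
proof -
  have "velocity (cnj h) = cnj (velocity h)" if "h \<in> strip" for h
    using cnj_csqrt[OF one_plus_square_strip(2)[OF that]] by (simp add: velocity_def)
  then show ?thesis
    using assms by (simp add: moment_map_def quad_integral_cnj continuous_on_strip_intros)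
qed

text \<open>At real multipliers the Jacobian is the Hessian of \<open>energy\<close>, a matrix of moments with the positive weight
\<open>(1 + h\<^sup>2) powr (- 3 / 2)\<close>.\<close>

lemma moment_jacobian_invertible:
  obtains M where "M o\<^sub>L moment_jacobian (of_real a, of_real b) = id_blinfun"
proof -
  define \<rho> where "\<rho> s = 1 / sqrt (1 + (a + b * s\<^sup>2)\<^sup>2) ^ 3" for s
  define m where "m k = integral {0..1} (\<lambda>s. s ^ k * \<rho> s)" for k :: nat
  have "continuous_on UNIV \<rho>"
    unfolding \<rho>_def by (intro continuous_intros) (simp add: one_plus_square_neq_0)
  moreover have "\<rho> s > 0" for s
    by (simp add: \<rho>_def one_plus_square_pos)
  ultimately have det: "m 0 * m 4 - m 2 * m 2 > 0"
    unfolding m_def by (rule weighted_moment_determinant_pos)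
  define \<Delta> where "\<Delta> = complex_of_real (m 0) * of_real (m 4) - of_real (m 2) * of_real (m 2)"
  have \<Delta>: "\<Delta> \<noteq> 0"
    using det by (simp add: \<Delta>_def flip: of_real_mult of_real_diff)
  have entry: "quad_integral velocity' k (of_real a, of_real b) = of_real (m k)" for k
    unfolding m_def \<rho>_def
    by (rule quad_integral_of_real[where g = "\<lambda>x. 1 / sqrt (1 + x\<^sup>2) ^ 3"])
       (auto simp: velocity'_def csqrt_one_plus_square_of_real one_plus_square_neq_0 intro!: continuous_intros)
  have "blinfun_mat2 (of_real (m 4) / \<Delta>) (- of_real (m 2) / \<Delta>) (- of_real (m 2) / \<Delta>) (of_real (m 0) / \<Delta>)
      o\<^sub>L moment_jacobian (of_real a, of_real b) = id_blinfun"
  proof (rule blinfun_eqI)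
    fix v :: "complex \<times> complex"
    obtain x y where v: "v = (x, y)" by (cases v)
    have "of_real (m 4) / \<Delta> * (of_real (m 0) * x + of_real (m 2) * y) +
        - of_real (m 2) / \<Delta> * (of_real (m 2) * x + of_real (m 4) * y) = \<Delta> * x / \<Delta>"
      "- of_real (m 2) / \<Delta> * (of_real (m 0) * x + of_real (m 2) * y) +
        of_real (m 0) / \<Delta> * (of_real (m 2) * x + of_real (m 4) * y) = \<Delta> * y / \<Delta>"
      using \<Delta> by (simp_all add: divide_simps) (simp_all add: \<Delta>_def algebra_simps)
    then show "blinfun_apply (blinfun_mat2 (of_real (m 4) / \<Delta>) (- of_real (m 2) / \<Delta>)
        (- of_real (m 2) / \<Delta>) (of_real (m 0) / \<Delta>) o\<^sub>L moment_jacobian (of_real a, of_real b)) v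
      = blinfun_apply id_blinfun v"
      using \<Delta> by (simp add: v moment_jacobian_def entry)
  qed
  then show thesis by (rule that)
qed

text \<open>The function \<open>F\<close> is the complexified optimal length composed with the local inverse \<open>g\<close> of the moment map.
It remains to see that \<open>g w\<close> is real for real \<open>w\<close>: the conjugate of \<open>g w\<close> solves the same equation, and
near the base point the solution is unique.\<close>

lemma opt_length_locally_holomorphic:
  obtains V F where "open V" "(of_real (moment 0 a b), of_real (moment 2 a b)) \<in> V"
    "complex_differentiable_on_2 F V"
    "\<And>\<eta> \<zeta> :: real. (of_real \<eta>, of_real \<zeta>) \<in> V \<Longrightarrow>
       \<exists>a' b'. moment 0 a' b' = \<eta> \<and> moment 2 a' b' = \<zeta> \<and> F (of_real \<eta>, of_real \<zeta>) = of_real (opt_length a' b')"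
proof -
  obtain M where M: "M o\<^sub>L moment_jacobian (of_real a, of_real b) = id_blinfun"
    by (rule moment_jacobian_invertible)
  have cont: "continuous_on tube moment_jacobian"
    unfolding moment_jacobian_def
    by (intro continuous_on_blinfun_mat2 continuous_on_quad_integral continuous_on_strip_intros)
  let ?p = "(complex_of_real a, complex_of_real b)"
  obtain U' V g g' where U': "open U'" "U' \<subseteq> tube" "?p \<in> U'" and V: "open V" "moment_map ?p \<in> V"
    and hom: "homeomorphism U' V moment_map g"
    and g: "\<And>w. w \<in> V \<Longrightarrow> (g has_derivative g' w) (at w)"
      "\<And>w. w \<in> V \<Longrightarrow> g' w = inv (blinfun_apply (moment_jacobian (g w)))"
      "\<And>w. w \<in> V \<Longrightarrow> bij (blinfun_apply (moment_jacobian (g w)))"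
    by (rule inverse_function_theorem[OF open_tube moment_map_has_derivative cont real_point_in_tube M]) (assumption | rule that)+
  define conj2 where "conj2 v = (cnj (fst v), cnj (snd v))" for v
  \<comment> \<open>On this set \<open>g w\<close> and its conjugate both lie in \<open>U'\<close>, where the moment map is injective.\<close>
  define V' where "V' = V \<inter> (\<lambda>w. conj2 (g w)) -` U'"
  have "continuous_on V g"
    using hom by (simp add: homeomorphism_def)
  then have "open V'"
    unfolding V'_def conj2_def
    by (intro continuous_open_preimage V U' continuous_intros)
  moreover have "moment_map ?p \<in> V'"
    using V U' homeomorphism_apply1[OF hom U'(3)] by (simp add: V'_def conj2_def)
  moreover have "complex_differentiable_on_2 (\<lambda>w. quad_integral lapse 0 (g w)) V'"
    unfolding complex_differentiable_on_2_def
  proof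
    fix w assume "w \<in> V'"
    then have w: "w \<in> V" by (simp add: V'_def)
    then have "g w \<in> tube"
      using hom U' by (auto simp: homeomorphism_def)
    from quad_integral_has_derivative[OF DERIV_lapse continuous_on_strip_intros(4) this]
    have F: "(quad_integral lapse 0 has_derivative
        (\<lambda>d. quad_integral lapse' 0 (g w) * fst d + quad_integral lapse' (0 + 2) (g w) * snd d)) (at (g w))" .
    obtain p q r s where "g' w = (\<lambda>d. (p * fst d + q * snd d, r * fst d + s * snd d))"
      using inverse_of_blinfun_mat2_complex_linear[OF g(3)[OF w, unfolded moment_jacobian_def]]
      unfolding g(2)[OF w] moment_jacobian_def by blast
    with has_derivative_compose[OF g(1)[OF w] F]
    have "((\<lambda>w. quad_integral lapse 0 (g w)) has_derivative
        (\<lambda>d. (quad_integral lapse' 0 (g w) * p + quad_integral lapse' 2 (g w) * r) * fst d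
           + (quad_integral lapse' 0 (g w) * q + quad_integral lapse' 2 (g w) * s) * snd d)) (at w)"
      by (elim has_derivative_eq_rhs) (simp add: fun_eq_iff algebra_simps numeral_2_eq_2)
    then show "\<exists>p q. ((\<lambda>w. quad_integral lapse 0 (g w)) has_derivative (\<lambda>d. p * fst d + q * snd d)) (at w)"
      by blast
  qed
  moreover have "\<exists>a' b'. moment 0 a' b' = \<eta> \<and> moment 2 a' b' = \<zeta> \<and>
      quad_integral lapse 0 (g (of_real \<eta>, of_real \<zeta>)) = of_real (opt_length a' b')"
    if w: "(of_real \<eta>, of_real \<zeta>) \<in> V'" for \<eta> \<zeta> :: real
  proof -
    let ?w = "(complex_of_real \<eta>, complex_of_real \<zeta>)"
    have wV: "?w \<in> V" and conj_w: "conj2 (g ?w) \<in> U'"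
      using w by (auto simp: V'_def)
    have "g ?w \<in> tube"
      using hom U' wV by (auto simp: homeomorphism_def)
    then have "moment_map (conj2 (g ?w)) = conj2 (moment_map (g ?w))"
      unfolding conj2_def by (rule moment_map_cnj)
    also have "\<dots> = ?w"
      using homeomorphism_apply2[OF hom wV] by (simp add: conj2_def)
    finally have "conj2 (g ?w) = g ?w"
      using homeomorphism_apply1[OF hom conj_w] by simp
    then have "fst (g ?w) \<in> \<real>" "snd (g ?w) \<in> \<real>"
      by (auto simp: conj2_def Reals_cnj_iff prod_eq_iff)
    then obtain a' b' where ab: "g ?w = (of_real a', of_real b')"
      by (metis Reals_cases prod.collapse)
    then have "(complex_of_real (moment 0 a' b'), complex_of_real (moment 2 a' b')) = ?w"
      using homeomorphism_apply2[OF hom wV] by (simp add: moment_map_of_real)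
    then show ?thesis
      using ab lapse_integral_of_real by auto
  qed
  ultimately show thesis
    by (intro that[of V' "\<lambda>w. quad_integral lapse 0 (g w)"]) (simp_all add: moment_map_of_real)
qed

section \<open>Power series of separately holomorphic functions\<close>

definition taylor_coeff :: "(complex \<Rightarrow> complex) \<Rightarrow> nat \<Rightarrow> complex" where
  "taylor_coeff f n = (deriv ^^ n) f 0 / fact n"

lemma taylor_coeff_sums:
  assumes "f holomorphic_on ball 0 R" "z \<in> ball 0 R"
  shows "(\<lambda>k. taylor_coeff f k * z ^ k) sums f z"
  using holomorphic_power_series[OF assms] by (simp add: taylor_coeff_def)

lemma taylor_coeff_bound:
  assumes hol: "f holomorphic_on ball 0 R" and \<rho>: "0 < \<rho>" "\<rho> < R"
    and bound: "\<And>z. z \<in> ball 0 R \<Longrightarrow> cmod (f z) \<le> M"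
  shows "cmod (taylor_coeff f n) \<le> M / \<rho> ^ n"
proof -
  have "cmod ((deriv ^^ n) f 0) \<le> fact n * M / \<rho> ^ n"
  proof (rule Cauchy_inequality[OF _ _ \<rho>(1)])
    show "f holomorphic_on ball 0 \<rho>"
      using hol \<rho> by (auto elim: holomorphic_on_subset)
    show "continuous_on (cball 0 \<rho>) f"
      using \<rho> by (intro holomorphic_on_imp_continuous_on holomorphic_on_subset[OF hol]) auto
    show "cmod (f z) \<le> M" if "cmod (0 - z) = \<rho>" for z
      using that \<rho> by (intro bound) auto
  qed
  then show ?thesis
    by (simp add: taylor_coeff_def norm_divide field_simps)
qed

text \<open>By the Cauchy estimates the tail is dominated by a geometric series. The bound depends on \<open>f\<close> only
through \<open>M\<close>, which gives uniformity for families of functions.\<close>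

lemma taylor_coeff_tail_bound:
  assumes hol: "f holomorphic_on ball 0 R" and \<rho>: "0 < \<rho>" "\<rho> < R"
    and bound: "\<And>z. z \<in> ball 0 R \<Longrightarrow> cmod (f z) \<le> M"
    and z: "cmod z < \<rho>"
  shows "cmod (f z - (\<Sum>k<n. taylor_coeff f k * z ^ k)) \<le> M * (cmod z / \<rho>) ^ n / (1 - cmod z / \<rho>)"
proof (rule norm_sums_le)
  have "(\<lambda>k. taylor_coeff f k * z ^ k) sums f z"
    using z \<rho> by (intro taylor_coeff_sums[OF hol]) simp
  then show "(\<lambda>k. taylor_coeff f (k + n) * z ^ (k + n)) sums (f z - (\<Sum>k<n. taylor_coeff f k * z ^ k))"
    by (rule sums_split_initial_segment)
  have "(\<lambda>k. (cmod z / \<rho>) ^ k) sums (1 / (1 - cmod z / \<rho>))"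
    using z \<rho> by (intro geometric_sums) simp
  from sums_mult[OF this, of "M * (cmod z / \<rho>) ^ n"]
  show "(\<lambda>k. M * (cmod z / \<rho>) ^ n * (cmod z / \<rho>) ^ k) sums (M * (cmod z / \<rho>) ^ n / (1 - cmod z / \<rho>))"
    by simp
  fix k
  have "cmod (taylor_coeff f (k + n) * z ^ (k + n)) \<le> M / \<rho> ^ (k + n) * cmod z ^ (k + n)"
    unfolding norm_mult norm_power
    by (intro mult_right_mono taylor_coeff_bound[OF hol \<rho> bound]) auto
  then show "cmod (taylor_coeff f (k + n) * z ^ (k + n)) \<le> M * (cmod z / \<rho>) ^ n * (cmod z / \<rho>) ^ k"
    by (simp add: power_divide power_add mult_ac)
qed

lemma taylor_coeff_has_sum:
  assumes hol: "f holomorphic_on ball 0 R" and \<rho>: "0 < \<rho>" "\<rho> < R"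
    and bound: "\<And>z. z \<in> ball 0 R \<Longrightarrow> cmod (f z) \<le> M"
    and z: "cmod z < \<rho>"
  shows "((\<lambda>k. taylor_coeff f k * z ^ k) has_sum f z) UNIV"
proof (rule norm_summable_imp_has_sum)
  show "(\<lambda>k. taylor_coeff f k * z ^ k) sums f z"
    using z \<rho> by (intro taylor_coeff_sums[OF hol]) simp
  show "summable (\<lambda>k. cmod (taylor_coeff f k * z ^ k))"
  proof (rule summable_comparison_test')
    show "summable (\<lambda>k. M * (cmod z / \<rho>) ^ k)"
      using z \<rho> by (intro summable_mult summable_geometric) simp
    fix k
    have "cmod (taylor_coeff f k) * cmod z ^ k \<le> M / \<rho> ^ k * cmod z ^ k"
      by (intro mult_right_mono taylor_coeff_bound[OF hol \<rho> bound]) auto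
    then show "norm (cmod (taylor_coeff f k * z ^ k)) \<le> M * (cmod z / \<rho>) ^ k"
      by (simp add: norm_mult norm_power power_divide)
  qed
qed

text \<open>The coefficient of index \<open>n\<close> is the limit, as \<open>z \<rightarrow> 0\<close>, of
\<open>(f w z - (\<Sum>k<n. taylor_coeff (f w) k * z ^ k)) / z ^ n\<close>. By induction these quotients are holomorphic
in \<open>w\<close>, and the bound on the Taylor tail makes the convergence uniform in \<open>w\<close>.\<close>

lemma holomorphic_taylor_coeff_parameter:
  fixes f :: "complex \<Rightarrow> complex \<Rightarrow> complex"
  assumes S: "open S" and \<rho>: "0 < \<rho>" "\<rho> < R"
    and hol: "\<And>w. w \<in> S \<Longrightarrow> f w holomorphic_on ball 0 R"
    and hol': "\<And>z. z \<in> ball 0 R \<Longrightarrow> (\<lambda>w. f w z) holomorphic_on S"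
    and bound: "\<And>w z. w \<in> S \<Longrightarrow> z \<in> ball 0 R \<Longrightarrow> cmod (f w z) \<le> M"
  shows "(\<lambda>w. taylor_coeff (f w) n) holomorphic_on S"
proof (induction n rule: less_induct)
  case (less n)
  \<comment> \<open>A null sequence inside the disc of radius \<open>\<rho>\<close>, chosen so that the error factor \<open>(\<bar>z\<bar> / \<rho>) / (1 - \<bar>z\<bar> / \<rho>)\<close> equals \<open>1 / (m + 1)\<close>.\<close>
  define z where "z m = complex_of_real (\<rho> / (real m + 2))" for m :: nat
  have z: "z m \<noteq> 0" "cmod (z m) = \<rho> / (real m + 2)" "cmod (z m) < \<rho>" for m
  proof -
    have "0 < \<rho> / (real m + 2)" "\<rho> / (real m + 2) < \<rho>"
      using \<rho> by (auto simp: field_simps add_pos_nonneg)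
    then show "z m \<noteq> 0" "cmod (z m) = \<rho> / (real m + 2)" "cmod (z m) < \<rho>"
      unfolding z_def norm_of_real of_real_eq_0_iff by linarith+
  qed
  have zR: "z m \<in> ball 0 R" for m
    using z(3)[of m] \<rho> by simp
  define g where "g m w = (f w (z m) - (\<Sum>k<n. taylor_coeff (f w) k * z m ^ k)) / z m ^ n" for m w
  have g_hol: "g m holomorphic_on S" for m
    unfolding g_def using z(1)[of m] less.IH zR[of m]
    by (intro holomorphic_intros hol') auto
  have g_close: "cmod (g m w - taylor_coeff (f w) n) \<le> (M / \<rho> ^ n) * inverse (real (Suc m))"
    if w: "w \<in> S" for m w
  proof -
    let ?x = "cmod (z m) / \<rho>"
    have x: "?x / (1 - ?x) = inverse (real (Suc m))"
    proof -
      have x1: "?x = 1 / (real m + 2)"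
        using \<rho> by (simp add: z(2))
      have x2: "1 - 1 / (real m + 2) = (real m + 1) / (real m + 2)"
        by (simp add: field_simps)
      show ?thesis
        unfolding x1 x2 by (simp add: field_simps)
    qed
    have "cmod (f w (z m) - (\<Sum>k<Suc n. taylor_coeff (f w) k * z m ^ k)) \<le> M * ?x ^ Suc n / (1 - ?x)"
      by (rule taylor_coeff_tail_bound[OF hol[OF w] \<rho> bound[OF w] z(3)])
    also have "\<dots> = M * ?x ^ n * (?x / (1 - ?x))"
      by simp
    also have "\<dots> = (M / \<rho> ^ n) * inverse (real (Suc m)) * cmod (z m) ^ n"
      unfolding x by (simp add: power_divide)
    finally have "cmod (f w (z m) - (\<Sum>k<Suc n. taylor_coeff (f w) k * z m ^ k)) / cmod (z m) ^ n
        \<le> (M / \<rho> ^ n) * inverse (real (Suc m))"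
      using z(1)[of m] by (subst pos_divide_le_eq) auto
    moreover have "g m w - taylor_coeff (f w) n
        = (f w (z m) - (\<Sum>k<Suc n. taylor_coeff (f w) k * z m ^ k)) / z m ^ n"
      using z(1)[of m] by (simp add: g_def field_simps)
    ultimately show ?thesis
      by (simp add: norm_divide norm_power)
  qed
  have lim: "uniform_limit S g (\<lambda>w. taylor_coeff (f w) n) sequentially"
  proof (rule uniform_limitI)
    fix e :: real assume "e > 0"
    have "(\<lambda>m. (M / \<rho> ^ n) * inverse (real (Suc m))) \<longlonglongrightarrow> 0"
      by (intro tendsto_mult_right_zero LIMSEQ_inverse_real_of_nat)
    then have "\<forall>\<^sub>F m in sequentially. (M / \<rho> ^ n) * inverse (real (Suc m)) < e"
      using \<open>e > 0\<close> by (rule order_tendstoD)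
    then show "\<forall>\<^sub>F m in sequentially. \<forall>w\<in>S. dist (g m w) (taylor_coeff (f w) n) < e"
      by eventually_elim (unfold dist_norm, blast intro: le_less_trans[OF g_close])
  qed
  show ?case
  proof (rule holomorphic_uniform_sequence[OF S g_hol])
    fix w assume "w \<in> S"
    with S obtain d where "0 < d" "cball w d \<subseteq> S"
      using open_contains_cball by blast
    then show "\<exists>d>0. cball w d \<subseteq> S \<and> uniform_limit (cball w d) g (\<lambda>w. taylor_coeff (f w) n) sequentially"
      using uniform_limit_on_subset[OF lim] by blast
  qed
qed

lemma summable_on_geometric_triple:
  fixes a b c :: real
  assumes "0 \<le> a" "a < 1" "0 \<le> b" "b < 1" "0 \<le> c" "c < 1" "0 \<le> M"
  shows "(\<lambda>(i, j, k). M * a ^ i * b ^ j * c ^ k) summable_on UNIV"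
proof -
  have geo: "((\<lambda>n. x ^ n) has_sum (1 / (1 - x))) UNIV" if "0 \<le> x" "x < 1" for x :: real
    using that by (intro norm_summable_imp_has_sum geometric_sums)
      (auto simp: norm_power intro!: summable_geometric)
  have jk: "((\<lambda>(j, k). b ^ j * c ^ k) has_sum 1 / (1 - b) * (1 / (1 - c))) (UNIV \<times> UNIV)"
  proof (rule has_sum_SigmaI)
    show "((\<lambda>k. case (j, k) of (j, k) \<Rightarrow> b ^ j * c ^ k) has_sum b ^ j * (1 / (1 - c))) UNIV" for j
      using has_sum_cmult_right[OF geo[of c]] assms by simp
    show "((\<lambda>j. b ^ j * (1 / (1 - c))) has_sum 1 / (1 - b) * (1 / (1 - c))) UNIV"
      by (intro has_sum_cmult_left geo assms)
    show "(\<lambda>(j, k). b ^ j * c ^ k) summable_on UNIV \<times> UNIV"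
    proof (rule summable_on_SigmaI)
      show "((\<lambda>k. case (j, k) of (j, k) \<Rightarrow> b ^ j * c ^ k) has_sum b ^ j * (1 / (1 - c))) UNIV" for j
        using has_sum_cmult_right[OF geo[of c]] assms by simp
      show "(\<lambda>j. b ^ j * (1 / (1 - c))) summable_on UNIV"
        using assms by (intro has_sum_imp_summable[OF has_sum_cmult_left[OF geo]])
    qed (use assms in auto)
  qed
  have "(\<lambda>(i, j, k). M * a ^ i * b ^ j * c ^ k) summable_on UNIV \<times> (UNIV \<times> UNIV)"
  proof (rule summable_on_SigmaI)
    show "((\<lambda>jk. case (i, jk) of (i, j, k) \<Rightarrow> M * a ^ i * b ^ j * c ^ k) has_sum
        M * a ^ i * (1 / (1 - b) * (1 / (1 - c)))) (UNIV \<times> UNIV)" for i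
      using has_sum_cmult_right[OF jk, of "M * a ^ i"] by (simp add: case_prod_unfold mult.assoc)
    show "(\<lambda>i. M * a ^ i * (1 / (1 - b) * (1 / (1 - c)))) summable_on UNIV"
      using assms by (intro has_sum_imp_summable[OF has_sum_cmult_left[OF has_sum_cmult_right[OF geo]]])
  qed (use assms in auto)
  then show ?thesis by simp
qed

text \<open>Expand in \<open>x\<close>, then the coefficients in \<open>y\<close>, then those in \<open>z\<close>. At each stage the coefficients
are again holomorphic in the remaining variables, and the Cauchy estimates multiply up to
\<open>M / \<rho> ^ (i + j + k)\<close>. So the triple series is dominated by a geometric one and the iterated sums
may be combined into one unconditional sum.\<close>

theorem Osgood_power_series_3:
  fixes f :: "complex \<Rightarrow> complex \<Rightarrow> complex \<Rightarrow> complex"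
  assumes R: "0 < R"
    and hol1: "\<And>y z. y \<in> ball 0 R \<Longrightarrow> z \<in> ball 0 R \<Longrightarrow> (\<lambda>x. f x y z) holomorphic_on ball 0 R"
    and hol2: "\<And>x z. x \<in> ball 0 R \<Longrightarrow> z \<in> ball 0 R \<Longrightarrow> (\<lambda>y. f x y z) holomorphic_on ball 0 R"
    and hol3: "\<And>x y. x \<in> ball 0 R \<Longrightarrow> y \<in> ball 0 R \<Longrightarrow> (\<lambda>z. f x y z) holomorphic_on ball 0 R"
    and bound: "\<And>x y z. x \<in> ball 0 R \<Longrightarrow> y \<in> ball 0 R \<Longrightarrow> z \<in> ball 0 R \<Longrightarrow> cmod (f x y z) \<le> M"
  shows "\<exists>c. \<forall>x y z. cmod x < R / 2 \<longrightarrow> cmod y < R / 2 \<longrightarrow> cmod z < R / 2 \<longrightarrow>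
      ((\<lambda>(i, j, k). c i j k * x ^ i * y ^ j * z ^ k) has_sum f x y z) UNIV"
proof -
  define \<rho> where "\<rho> = R / 2"
  have \<rho>: "0 < \<rho>" "\<rho> < R"
    using R by (auto simp: \<rho>_def)
  let ?B = "ball (0::complex) R"
  define A where "A i y z = taylor_coeff (\<lambda>x. f x y z) i" for i y z
  define B where "B i j z = taylor_coeff (\<lambda>y. A i y z) j" for i j z
  define C where "C i j k = taylor_coeff (B i j) k" for i j k
  have A2: "(\<lambda>y. A i y z) holomorphic_on ?B" if "z \<in> ?B" for i z
    unfolding A_def using that
    by (intro holomorphic_taylor_coeff_parameter[OF open_ball \<rho>, of 0 R "\<lambda>y x. f x y z" M] hol1 hol2 bound) auto
  have A3: "(\<lambda>z. A i y z) holomorphic_on ?B" if "y \<in> ?B" for i y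
    unfolding A_def using that
    by (intro holomorphic_taylor_coeff_parameter[OF open_ball \<rho>, of 0 R "\<lambda>z x. f x y z" M] hol1 hol3 bound) auto
  have A_bound: "cmod (A i y z) \<le> M / \<rho> ^ i" if "y \<in> ?B" "z \<in> ?B" for i y z
    unfolding A_def using that by (intro taylor_coeff_bound[OF _ \<rho>] hol1 bound)
  have B3: "B i j holomorphic_on ?B" for i j
    unfolding B_def
    by (intro holomorphic_taylor_coeff_parameter[OF open_ball \<rho>, of 0 R "\<lambda>z y. A i y z" "M / \<rho> ^ i"] A2 A3 A_bound) auto
  have B_bound: "cmod (B i j z) \<le> M / \<rho> ^ i / \<rho> ^ j" if "z \<in> ?B" for i j z
    unfolding B_def using that by (intro taylor_coeff_bound[OF _ \<rho>] A2 A_bound)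
  have C_bound: "cmod (C i j k) \<le> M / \<rho> ^ i / \<rho> ^ j / \<rho> ^ k" for i j k
    unfolding C_def by (intro taylor_coeff_bound[OF _ \<rho>] B3 B_bound)
  have M: "0 \<le> M"
    using R by (intro order_trans[OF norm_ge_zero bound[of 0 0 0]]) auto
  show ?thesis
  proof (intro exI[of _ C] allI impI)
    fix x y z assume xyz: "cmod x < R / 2" "cmod y < R / 2" "cmod z < R / 2"
    then have small: "cmod x < \<rho>" "cmod y < \<rho>" "cmod z < \<rho>" and ball: "y \<in> ?B" "z \<in> ?B"
      using R by (auto simp: \<rho>_def)
    have x_sum: "((\<lambda>i. A i y z * x ^ i) has_sum f x y z) UNIV"
      using taylor_coeff_has_sum[OF hol1[OF ball] \<rho> bound[OF _ ball] small(1)] by (simp add: A_def)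
    have y_sum: "((\<lambda>j. B i j z * y ^ j) has_sum A i y z) UNIV" for i
      using taylor_coeff_has_sum[OF A2[OF ball(2)] \<rho> A_bound[OF _ ball(2)] small(2)] by (simp add: B_def)
    have z_sum: "((\<lambda>k. C i j k * z ^ k) has_sum B i j z) UNIV" for i j
      using taylor_coeff_has_sum[OF B3 \<rho> B_bound small(3)] by (simp add: C_def)
    define T where "T p = (case p of (i, j, k) \<Rightarrow> C i j k * x ^ i * y ^ j * z ^ k)" for p
    define G where "G p = (case p of (i, j, k) \<Rightarrow>
      M * (cmod x / \<rho>) ^ i * (cmod y / \<rho>) ^ j * (cmod z / \<rho>) ^ k)" for p :: "nat \<times> nat \<times> nat"
    have "G summable_on UNIV"
      unfolding G_def using small \<rho> M by (intro summable_on_geometric_triple) auto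
    moreover have "norm (T p) \<le> G p" for p
    proof (cases p)
      case (fields i j k)
      have "cmod (C i j k) * (cmod x ^ i * cmod y ^ j * cmod z ^ k)
          \<le> M / \<rho> ^ i / \<rho> ^ j / \<rho> ^ k * (cmod x ^ i * cmod y ^ j * cmod z ^ k)"
        by (intro mult_right_mono C_bound) auto
      then show ?thesis
        by (simp add: T_def G_def fields norm_mult norm_power power_divide mult_ac)
    qed
    ultimately have "(\<lambda>p. norm (T p)) summable_on UNIV"
      using Infinite_Sum.abs_summable_on_comparison_test'[of G UNIV T] by simp
    then have summable: "T summable_on (UNIV \<times> UNIV)"
      using Infinite_Sum.abs_summable_summable[of T UNIV] by simp
    have "(T has_sum f x y z) (UNIV \<times> UNIV)"
    proof (rule has_sum_SigmaI[OF _ x_sum summable])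
      fix i :: nat
      have summable_i: "(\<lambda>jk. T (i, jk)) summable_on (UNIV \<times> UNIV)"
        using summable_on_SigmaD1[of "\<lambda>i jk. T (i, jk)" UNIV "\<lambda>_. UNIV" i] summable
        by simp
      have y_sum': "((\<lambda>j. B i j z * y ^ j * x ^ i) has_sum A i y z * x ^ i) UNIV"
        by (intro has_sum_cmult_left y_sum)
      have "((\<lambda>jk. T (i, jk)) has_sum A i y z * x ^ i) (UNIV \<times> UNIV)"
      proof (rule has_sum_SigmaI[OF _ y_sum' summable_i])
        show "((\<lambda>k. T (i, (j, k))) has_sum B i j z * y ^ j * x ^ i) UNIV" for j
          using has_sum_cmult_left[OF z_sum, of i j "y ^ j * x ^ i"] by (simp add: T_def mult_ac)
      qed
      then show "((\<lambda>jk. T (i, jk)) has_sum A i y z * x ^ i) UNIV"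
        by simp
    qed
    then show "((\<lambda>(i, j, k). C i j k * x ^ i * y ^ j * z ^ k) has_sum f x y z) UNIV"
      unfolding T_def by simp
  qed
qed

lemma real_power_series_3:
  fixes \<phi> :: "real^3 \<Rightarrow> real" and f :: "complex \<Rightarrow> complex \<Rightarrow> complex \<Rightarrow> complex"
  assumes R: "0 < R"
    and hol1: "\<And>y z. y \<in> ball 0 R \<Longrightarrow> z \<in> ball 0 R \<Longrightarrow> (\<lambda>x. f x y z) holomorphic_on ball 0 R"
    and hol2: "\<And>x z. x \<in> ball 0 R \<Longrightarrow> z \<in> ball 0 R \<Longrightarrow> (\<lambda>y. f x y z) holomorphic_on ball 0 R"
    and hol3: "\<And>x y. x \<in> ball 0 R \<Longrightarrow> y \<in> ball 0 R \<Longrightarrow> (\<lambda>z. f x y z) holomorphic_on ball 0 R"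
    and bound: "\<And>x y z. x \<in> ball 0 R \<Longrightarrow> y \<in> ball 0 R \<Longrightarrow> z \<in> ball 0 R \<Longrightarrow> cmod (f x y z) \<le> M"
    and \<phi>: "\<And>q. q \<in> ball p (R / 2) \<Longrightarrow>
      \<phi> q = Re (f (of_real (q $ 1 - p $ 1)) (of_real (q $ 2 - p $ 2)) (of_real (q $ 3 - p $ 3)))"
  shows "\<exists>r>0. \<exists>c :: nat^3 \<Rightarrow> real. \<forall>x\<in>ball p r.
        ((\<lambda>\<alpha>. c \<alpha> * (\<Prod>i\<in>UNIV. (x $ i - p $ i) ^ (\<alpha> $ i))) has_sum \<phi> x) UNIV"
proof -
  have "\<exists>c. \<forall>x y z. cmod x < R / 2 \<longrightarrow> cmod y < R / 2 \<longrightarrow> cmod z < R / 2 \<longrightarrow>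
      ((\<lambda>(i, j, k). c i j k * x ^ i * y ^ j * z ^ k) has_sum f x y z) UNIV"
    by (rule Osgood_power_series_3) fact+
  then obtain c where c: "\<forall>x y z. cmod x < R / 2 \<longrightarrow> cmod y < R / 2 \<longrightarrow> cmod z < R / 2 \<longrightarrow>
      ((\<lambda>(i, j, k). c i j k * x ^ i * y ^ j * z ^ k) has_sum f x y z) UNIV" ..
  have "((\<lambda>\<alpha> :: nat^3. Re (c (\<alpha> $ 1) (\<alpha> $ 2) (\<alpha> $ 3)) * (\<Prod>i\<in>UNIV. (x $ i - p $ i) ^ (\<alpha> $ i))) has_sum \<phi> x) UNIV"
    if x: "x \<in> ball p (R / 2)" for x
  proof -
    define h where "h i = x $ i - p $ i" for i
    have "\<bar>h i\<bar> < R / 2" for i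
      using component_le_norm_cart[of "x - p" i] x by (simp add: h_def dist_norm norm_minus_commute)
    then have "((\<lambda>(i, j, k). c i j k * of_real (h 1) ^ i * of_real (h 2) ^ j * of_real (h 3) ^ k)
        has_sum f (of_real (h 1)) (of_real (h 2)) (of_real (h 3))) UNIV"
      by (intro c[rule_format]) auto
    from has_sum_Re[OF this]
    have "((\<lambda>(i, j, k). Re (c i j k) * (h 1 ^ i * h 2 ^ j * h 3 ^ k)) has_sum \<phi> x) UNIV"
      by (simp add: \<phi>[OF x] h_def[symmetric] case_prod_unfold mult.assoc flip: of_real_power of_real_mult)
    moreover have "(\<Prod>i\<in>UNIV. (x $ i - p $ i) ^ (\<alpha> $ i)) = h 1 ^ (\<alpha> $ 1) * h 2 ^ (\<alpha> $ 2) * h 3 ^ (\<alpha> $ 3)"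
      for \<alpha> :: "nat^3"
      unfolding UNIV_3 by (simp add: h_def mult.assoc)
    ultimately show ?thesis
      by (subst has_sum_reindex_bij_witness[of UNIV "\<lambda>(i, j, k). vector [i, j, k]" "\<lambda>\<alpha>. (\<alpha> $ 1, \<alpha> $ 2, \<alpha> $ 3)" UNIV])
         (auto simp: vec_eq_iff forall_3)
  qed
  then show ?thesis
    using R by (intro exI[of _ "R / 2"] conjI exI[of _ "\<lambda>\<alpha>. Re (c (\<alpha> $ 1) (\<alpha> $ 2) (\<alpha> $ 3))"]) auto
qed

section \<open>Analyticity and continuity of the distance\<close>

text \<open>Complex differentiability in two variables is used only through this: the composition with a pair of
holomorphic functions of one variable is holomorphic.\<close>

lemma complex_differentiable_on_2_compose:
  assumes F: "complex_differentiable_on_2 F V" and V: "(f x, g x) \<in> V"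
    and f: "f field_differentiable (at x)" and g: "g field_differentiable (at x)"
  shows "(\<lambda>x. F (f x, g x)) field_differentiable (at x)"
proof -
  obtain p q where F': "(F has_derivative (\<lambda>d. p * fst d + q * snd d)) (at (f x, g x))"
    using F V by (auto simp: complex_differentiable_on_2_def)
  obtain f' g' where "(f has_derivative (*) f') (at x)" "(g has_derivative (*) g') (at x)"
    using f g by (auto simp: field_differentiable_def has_field_derivative_def)
  from has_derivative_compose[OF has_derivative_Pair[OF this] F']
  have "((\<lambda>x. F (f x, g x)) has_derivative (*) (p * f' + q * g')) (at x)"
    by (rule has_derivative_eq_rhs) (simp add: fun_eq_iff algebra_simps)
  then show ?thesis
    by (auto simp: field_differentiable_def has_field_derivative_def)
qed

lemma complex_differentiable_on_2_continuous:
  assumes "complex_differentiable_on_2 F V"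
  shows "continuous_on V F"
  using assms unfolding complex_differentiable_on_2_def
  by (meson continuous_at_imp_continuous_on has_derivative_continuous)

lemma attainable_iff:
  "p \<in> attainable 0 \<longleftrightarrow> (\<exists>t1 u q. admissible t1 u q \<and> q 0 = 0 \<and> q t1 = p)"
  by (auto simp: attainable_def)

lemma attainable_abscissa_nonneg: "p \<in> attainable 0 \<Longrightarrow> 0 \<le> p $ 1"
  using length_le_abscissa(3) by (auto simp: attainable_iff)

lemma sub_Lorentzian_dist_bounds:
  assumes "p \<in> attainable 0"
    and le: "\<And>t1 u q. admissible t1 u q \<Longrightarrow> q 0 = 0 \<Longrightarrow> q t1 = p \<Longrightarrow> traj_length t1 u \<le> B"
  shows "0 \<le> sub_Lorentzian_dist 0 p" "sub_Lorentzian_dist 0 p \<le> B"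
proof -
  let ?S = "{traj_length t1 u | t1 u q. admissible t1 u q \<and> q 0 = 0 \<and> q t1 = p}"
  obtain t1 u q where q: "admissible t1 u q" "q 0 = 0" "q t1 = p"
    using assms(1) by (auto simp: attainable_iff)
  then have mem: "traj_length t1 u \<in> ?S"
    by blast
  have "bdd_above ?S"
    using le by (auto intro!: bdd_aboveI[of _ B])
  then have "traj_length t1 u \<le> Sup ?S"
    using mem by (rule cSup_upper[rotated])
  then show "0 \<le> sub_Lorentzian_dist 0 p"
    using assms(1) length_le_abscissa(1)[OF q(1,2)] by (simp add: sub_Lorentzian_dist_def)
  have "Sup ?S \<le> B"
    using mem le by (intro cSup_least) blast+
  then show "sub_Lorentzian_dist 0 p \<le> B"
    using assms(1) by (simp add: sub_Lorentzian_dist_def)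
qed

lemma sub_Lorentzian_dist_nonneg: "0 \<le> sub_Lorentzian_dist 0 p"
proof (cases "p \<in> attainable 0")
  case True
  then show ?thesis
    using sub_Lorentzian_dist_bounds(1)[OF True, of "p $ 1"] length_le_abscissa(2) by blast
qed (simp add: sub_Lorentzian_dist_def)

lemma sub_Lorentzian_dist_le_abscissa: "sub_Lorentzian_dist 0 p \<le> max 0 (p $ 1)"
proof (cases "p \<in> attainable 0")
  case True
  have "sub_Lorentzian_dist 0 p \<le> p $ 1"
    using sub_Lorentzian_dist_bounds(2)[OF True, of "p $ 1"] length_le_abscissa(2) by blast
  then show ?thesis by simp
qed (simp add: sub_Lorentzian_dist_def)

lemma sub_Lorentzian_dist_le_dual:
  assumes "p \<in> attainable 0" "p $ 1 > 0"
  shows "sub_Lorentzian_dist 0 p \<le> p $ 1 * energy a b - (a * p $ 2 + 2 * b / (p $ 1)\<^sup>2 * p $ 3)"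
proof (rule sub_Lorentzian_dist_bounds(2)[OF assms(1)])
  fix t1 u q assume "admissible t1 u q" "q 0 = 0" "q t1 = p"
  then show "traj_length t1 u \<le> p $ 1 * energy a b - (a * p $ 2 + 2 * b / (p $ 1)\<^sup>2 * p $ 3)"
    using length_le_dual[of t1 u q "p $ 1"] assms(2) by simp
qed

text \<open>The point \<open>p\<close> is reached by the extremal with multipliers \<open>a\<close> and \<open>b\<close>. The quotients are the moments
normalised by the dilations of the problem, under which the coordinates have weights 1, 1 and 3.\<close>

definition extremal_endpoint :: "real \<Rightarrow> real \<Rightarrow> real^3 \<Rightarrow> bool" where
  "extremal_endpoint a b p \<longleftrightarrow>
     p $ 1 > 0 \<and> moment 0 a b = p $ 2 / p $ 1 \<and> moment 2 a b = 2 * p $ 3 / (p $ 1) ^ 3"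

lemma normalised_pairing:
  fixes X :: real
  assumes "X > 0"
  shows "a * y + 2 * b / X\<^sup>2 * z = X * (a * (y / X) + b * (2 * z / X ^ 3))"
  using assms by (simp add: field_simps power2_eq_square power3_eq_cube)

text \<open>The extremal trajectory attains the dual bound at its own multipliers.\<close>

lemma extremal_endpoint_dist:
  assumes "extremal_endpoint a b p"
  shows "p \<in> attainable 0" "sub_Lorentzian_dist 0 p = p $ 1 * opt_length a b"
proof -
  have X: "p $ 1 > 0" and m: "moment 0 a b = p $ 2 / p $ 1" "moment 2 a b = 2 * p $ 3 / (p $ 1) ^ 3"
    using assms by (auto simp: extremal_endpoint_def)
  obtain u q where q: "admissible (p $ 1) u q" "q 0 = 0"
    "q (p $ 1) $ 1 = p $ 1" "q (p $ 1) $ 2 = p $ 1 * moment 0 a b"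
    "q (p $ 1) $ 3 = (p $ 1) ^ 3 / 2 * moment 2 a b"
    and len: "traj_length (p $ 1) u = p $ 1 * opt_length a b"
    by (rule extremal_trajectory[OF X])
  have qp: "q (p $ 1) = p"
    using q(3-5) X m by (simp add: vec_eq_iff forall_3)
  show att: "p \<in> attainable 0"
    using q(1,2) qp by (auto simp: attainable_iff)
  let ?S = "{traj_length t1 u | t1 u q. admissible t1 u q \<and> q 0 = 0 \<and> q t1 = p}"
  have "Sup ?S = p $ 1 * opt_length a b"
  proof (rule cSup_eq_maximum)
    show "p $ 1 * opt_length a b \<in> ?S"
      using q(1,2) qp len by (intro CollectI) metis
    fix l assume "l \<in> ?S"
    then obtain t1 u' q' where q': "l = traj_length t1 u'" "admissible t1 u' q'" "q' 0 = 0" "q' t1 = p"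
      by blast
    then have "l \<le> p $ 1 * energy a b - (a * p $ 2 + 2 * b / (p $ 1)\<^sup>2 * p $ 3)"
      using length_le_dual[OF q'(2,3), of "p $ 1"] X by simp
    also have "\<dots> = p $ 1 * opt_length a b"
      unfolding normalised_pairing[OF X] opt_length_eq_Legendre m by (simp add: right_diff_distrib distrib_left)
    finally show "l \<le> p $ 1 * opt_length a b" .
  qed
  then show "sub_Lorentzian_dist 0 p = p $ 1 * opt_length a b"
    using att by (simp add: sub_Lorentzian_dist_def)
qed

lemma extremal_or_supported:
  assumes "p $ 1 > 0"
  obtains a b where "extremal_endpoint a b p"
  | a b where "(a, b) \<noteq> (0, 0)"
      "integral {0..1} (\<lambda>s. \<bar>a + b * s\<^sup>2\<bar>) \<le> a * (p $ 2 / p $ 1) + b * (2 * p $ 3 / (p $ 1) ^ 3)"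
  using moments_surjective[of "p $ 2 / p $ 1" "2 * p $ 3 / (p $ 1) ^ 3"] assms
  unfolding extremal_endpoint_def by (metis not_less)

text \<open>If there were a supporting direction \<open>(a, b)\<close> at \<open>p\<close>, adding a small multiple of \<open>(0, a, b)\<close> to
\<open>p\<close> would leave the half-space of \<open>endpoint_le_support\<close>, which contains all attainable points with
the same first coordinate.\<close>

lemma interior_attainable_extremal:
  assumes "p \<in> interior (attainable 0)"
  obtains a b where "extremal_endpoint a b p"
proof -
  obtain e where e: "e > 0" "ball p e \<subseteq> attainable 0"
    using assms by (auto simp: mem_interior)
  have near: "p + d *\<^sub>R v \<in> attainable 0" if "0 \<le> d" "d * norm v < e" for d v
    using that e(2) by (auto simp: dist_norm)
  have X: "p $ 1 > 0"
  proof -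
    \<comment> \<open>Attainable points have nonnegative first coordinate, also after a shift to the left.\<close>
    have "p + (e / 2) *\<^sub>R (- axis 1 1) \<in> attainable 0"
      using e(1) by (intro near) (auto simp: norm_axis_1)
    from attainable_abscissa_nonneg[OF this] show ?thesis
      using e(1) by (simp add: axis_def)
  qed
  show thesis
  proof (rule extremal_or_supported[OF X])
    fix a b :: real
    assume ab: "(a, b) \<noteq> (0, 0)"
      "integral {0..1} (\<lambda>s. \<bar>a + b * s\<^sup>2\<bar>) \<le> a * (p $ 2 / p $ 1) + b * (2 * p $ 3 / (p $ 1) ^ 3)"
    define v where "v = (vector [0, a, b] :: real^3)"
    \<comment> \<open>A positive step for which the displaced point remains in the ball.\<close>
    define d where "d = e / (norm v + 1)"
    define c where "c = 2 * b / (p $ 1)\<^sup>2"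
    have norm_v: "norm v + 1 > 0"
      by (simp add: add_nonneg_pos)
    then have d: "d > 0" "d * norm v < e"
      using e(1) by (simp_all add: d_def pos_divide_less_eq distrib_left)
    have "p + d *\<^sub>R v \<in> attainable 0"
      using d by (intro near) auto
    then obtain t1 u q where q: "admissible t1 u q" "q 0 = 0" "q t1 = p + d *\<^sub>R v"
      by (auto simp: attainable_iff)
    have "a * (p $ 2 + d * a) + 2 * b / (p $ 1)\<^sup>2 * (p $ 3 + d * b)
        \<le> p $ 1 * integral {0..1} (\<lambda>s. \<bar>a + b * s\<^sup>2\<bar>)"
      using endpoint_le_support[OF q(1,2), of "p $ 1" a b] X by (simp add: q(3) v_def)
    also have "\<dots> \<le> a * p $ 2 + 2 * b / (p $ 1)\<^sup>2 * p $ 3"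
      unfolding normalised_pairing[OF X] using ab(2) X by (intro mult_left_mono) auto
    finally have le: "a * (p $ 2 + d * a) + c * (p $ 3 + d * b) \<le> a * p $ 2 + c * p $ 3"
      unfolding c_def .
    have "d * (a\<^sup>2 + c * b) \<le> 0"
      using le by (simp add: algebra_simps power2_eq_square)
    then have "d * (a\<^sup>2 + 2 * b\<^sup>2 / (p $ 1)\<^sup>2) \<le> 0"
      by (simp add: c_def power2_eq_square mult.assoc)
    moreover have "a\<^sup>2 + 2 * b\<^sup>2 / (p $ 1)\<^sup>2 > 0"
    proof (cases "a = 0")
      case True
      then show ?thesis using ab(1) X by simp
    next
      case False
      then show ?thesis by (simp add: add_pos_nonneg)
    qed
    ultimately show thesis
      using d(1) by (simp add: mult_le_0_iff)
  qed (rule that)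
qed

definition displacement :: "real^3 \<Rightarrow> real^3 \<Rightarrow> complex \<times> complex \<times> complex" where
  "displacement p q = (of_real (q $ 1 - p $ 1), of_real (q $ 2 - p $ 2), of_real (q $ 3 - p $ 3))"

text \<open>The distance is \<open>X\<close> times the optimal length at the moments \<open>(Y / X, 2 Z / X\<^sup>3)\<close>, and both factors
make sense for complex \<open>X\<close>, \<open>Y\<close>, \<open>Z\<close> near the coordinates of \<open>p\<close>. The set \<open>P\<close> keeps the
denominators away from zero and the first coordinate of real points positive.\<close>

lemma extremal_endpoint_local_extension:
  assumes "extremal_endpoint a b p"
  obtains W h where "open W" "(0, 0, 0) \<in> W" "continuous_on W h"
    "\<And>x y z. (x, y, z) \<in> W \<Longrightarrow> (\<lambda>x. h (x, y, z)) field_differentiable (at x)"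
    "\<And>x y z. (x, y, z) \<in> W \<Longrightarrow> (\<lambda>y. h (x, y, z)) field_differentiable (at y)"
    "\<And>x y z. (x, y, z) \<in> W \<Longrightarrow> (\<lambda>z. h (x, y, z)) field_differentiable (at z)"
    "\<And>q. displacement p q \<in> W \<Longrightarrow> sub_Lorentzian_dist 0 q = Re (h (displacement p q))"
proof -
  have X: "p $ 1 > 0" and m: "moment 0 a b = p $ 2 / p $ 1" "moment 2 a b = 2 * p $ 3 / (p $ 1) ^ 3"
    using assms by (auto simp: extremal_endpoint_def)
  obtain V F where V: "open V" "(of_real (moment 0 a b), of_real (moment 2 a b)) \<in> V"
    and F: "complex_differentiable_on_2 F V"
    and F_real: "\<And>\<eta> \<zeta> :: real. (of_real \<eta>, of_real \<zeta>) \<in> V \<Longrightarrow>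
       \<exists>a' b'. moment 0 a' b' = \<eta> \<and> moment 2 a' b' = \<zeta> \<and> F (of_real \<eta>, of_real \<zeta>) = of_real (opt_length a' b')"
    by (rule opt_length_locally_holomorphic[of a b]) (assumption | rule that)+
  define N where "N = (\<lambda>(x, y, z). ((of_real (p $ 2) + y) / (of_real (p $ 1) + x),
      2 * (of_real (p $ 3) + z) / (of_real (p $ 1) + x) ^ 3) :: complex \<times> complex)"
  define P where "P = {w :: complex \<times> complex \<times> complex. - (p $ 1) < Re (fst w)}"
  define W where "W = P \<inter> N -` V"
  define h where "h = (\<lambda>w. (of_real (p $ 1) + fst w) * F (N w))"
  have P_nz: "of_real (p $ 1) + fst w \<noteq> 0" if "w \<in> P" for w
  proof -
    have "Re (of_real (p $ 1) + fst w) > 0"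
      using that by (simp add: P_def)
    then show ?thesis by force
  qed
  have "open P"
    unfolding P_def by (intro open_Collect_less continuous_intros)
  moreover have contN: "continuous_on P N"
    unfolding N_def case_prod_unfold using P_nz by (intro continuous_intros) auto
  ultimately have "open W"
    unfolding W_def using V(1) by (intro continuous_open_preimage)
  moreover have "(0, 0, 0) \<in> W"
    using X V(2) by (simp add: W_def P_def N_def m)
  moreover have "continuous_on W h"
    unfolding h_def W_def
    by (intro continuous_intros continuous_on_compose2[OF complex_differentiable_on_2_continuous[OF F]]
        continuous_on_subset[OF contN]) auto
  moreover have
    "(\<lambda>x. h (x, y, z)) field_differentiable (at x)"
    "(\<lambda>y. h (x, y, z)) field_differentiable (at y)"
    "(\<lambda>z. h (x, y, z)) field_differentiable (at z)" if w: "(x, y, z) \<in> W" for x y z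
  proof -
    have nz: "of_real (p $ 1) + x \<noteq> 0"
      using P_nz[of "(x, y, z)"] w by (simp add: W_def)
    have NV: "((of_real (p $ 2) + y) / (of_real (p $ 1) + x), 2 * (of_real (p $ 3) + z) / (of_real (p $ 1) + x) ^ 3) \<in> V"
      using w by (simp add: W_def N_def)
    show "(\<lambda>x. h (x, y, z)) field_differentiable (at x)"
      unfolding h_def N_def fst_conv case_prod_conv
      by (intro field_differentiable_mult complex_differentiable_on_2_compose[OF F] NV
          field_differentiable_divide field_differentiable_power field_differentiable_add derivative_intros)
         (use nz in simp_all)
    show "(\<lambda>y. h (x, y, z)) field_differentiable (at y)"
      unfolding h_def N_def fst_conv case_prod_conv
      by (intro field_differentiable_mult complex_differentiable_on_2_compose[OF F] NV
          field_differentiable_divide field_differentiable_power field_differentiable_add derivative_intros)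
         (use nz in simp_all)
    show "(\<lambda>z. h (x, y, z)) field_differentiable (at z)"
      unfolding h_def N_def fst_conv case_prod_conv
      by (intro field_differentiable_mult complex_differentiable_on_2_compose[OF F] NV
          field_differentiable_divide field_differentiable_power field_differentiable_add derivative_intros)
         (use nz in simp_all)
  qed
  moreover have "sub_Lorentzian_dist 0 q = Re (h (displacement p q))"
    if q: "displacement p q \<in> W" for q
  proof -
    have q1: "q $ 1 > 0"
      using q by (simp add: displacement_def W_def P_def)
    have Nq: "N (displacement p q) = (of_real (q $ 2 / q $ 1), of_real (2 * q $ 3 / (q $ 1) ^ 3))"
      by (simp add: N_def displacement_def)
    then have "(complex_of_real (q $ 2 / q $ 1), complex_of_real (2 * q $ 3 / (q $ 1) ^ 3)) \<in> V"
      using q by (simp add: W_def)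
    from F_real[OF this] obtain a' b' where ab: "moment 0 a' b' = q $ 2 / q $ 1"
      "moment 2 a' b' = 2 * q $ 3 / (q $ 1) ^ 3" "F (N (displacement p q)) = of_real (opt_length a' b')"
      unfolding Nq by blast
    have "extremal_endpoint a' b' q"
      using q1 ab by (simp add: extremal_endpoint_def)
    moreover have "h (displacement p q) = of_real (q $ 1 * opt_length a' b')"
      using ab(3) by (simp add: h_def displacement_def)
    ultimately show ?thesis
      using extremal_endpoint_dist(2) by auto
  qed
  ultimately show thesis
    by (intro that[of W h]) blast+
qed

lemma continuous_on_displacement: "continuous_on UNIV (displacement p)"
  unfolding displacement_def[abs_def] by (intro continuous_intros)

lemma eventually_displacement_in:
  assumes "open W" "(0, 0, 0) \<in> W"
  shows "\<forall>\<^sub>F q in nhds p. displacement p q \<in> W"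
proof -
  have "open (displacement p -` W)"
    using continuous_on_displacement assms(1) by (simp add: continuous_on_open_vimage)
  moreover have "p \<in> displacement p -` W"
    using assms(2) by (simp add: displacement_def)
  ultimately have "\<forall>\<^sub>F q in nhds p. q \<in> displacement p -` W"
    by (rule eventually_nhds_in_open)
  then show ?thesis by simp
qed

lemma polydisc_in_open_set:
  assumes "open W" "((0, 0, 0) :: complex \<times> complex \<times> complex) \<in> W" "continuous_on W h"
  obtains R M where "R > 0"
    "\<And>x y z. x \<in> ball 0 R \<Longrightarrow> y \<in> ball 0 R \<Longrightarrow> z \<in> ball 0 R \<Longrightarrow> (x, y, z) \<in> W \<and> cmod (h (x, y, z)) \<le> M"
proof -
  obtain e where e: "e > 0" "cball (0, 0, 0) e \<subseteq> W"
    using assms(1,2) open_contains_cball by blast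
  have "compact (h ` cball (0, 0, 0) e)"
    using e(2) by (intro compact_continuous_image continuous_on_subset[OF assms(3)]) auto
  then have "bounded (h ` cball (0, 0, 0) e)"
    by (rule compact_imp_bounded)
  then obtain M where M: "\<And>w. w \<in> cball (0, 0, 0) e \<Longrightarrow> cmod (h w) \<le> M"
    unfolding bounded_iff by blast
  have "(x, y, z) \<in> cball (0, 0, 0) e"
    if "x \<in> ball 0 (e / 3)" "y \<in> ball 0 (e / 3)" "z \<in> ball 0 (e / 3)" for x y z :: complex
  proof -
    have "norm (x, y, z) \<le> norm x + norm (y, z)" "norm (y, z) \<le> norm y + norm z"
      by (rule norm_Pair_le)+
    then have "norm (x, y, z) \<le> e"
      using that by simp
    moreover have "((0, 0, 0) :: complex \<times> complex \<times> complex) = 0"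
      by (simp add: zero_prod_def)
    ultimately show ?thesis
      by simp
  qed
  then show thesis
    using e M by (intro that[of "e / 3" M]) (simp, blast)
qed

theorem extremal_endpoint_power_series:
  assumes "extremal_endpoint a b p"
  shows "\<exists>r>0. \<exists>c :: nat^3 \<Rightarrow> real. \<forall>x\<in>ball p r.
        ((\<lambda>\<alpha>. c \<alpha> * (\<Prod>i\<in>UNIV. (x $ i - p $ i) ^ (\<alpha> $ i))) has_sum sub_Lorentzian_dist 0 x) UNIV"
proof -
  obtain W h where W: "open W" "(0, 0, 0) \<in> W" "continuous_on W h"
    and h: "\<And>x y z. (x, y, z) \<in> W \<Longrightarrow> (\<lambda>x. h (x, y, z)) field_differentiable (at x)"
    "\<And>x y z. (x, y, z) \<in> W \<Longrightarrow> (\<lambda>y. h (x, y, z)) field_differentiable (at y)"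
    "\<And>x y z. (x, y, z) \<in> W \<Longrightarrow> (\<lambda>z. h (x, y, z)) field_differentiable (at z)"
    "\<And>q. displacement p q \<in> W \<Longrightarrow> sub_Lorentzian_dist 0 q = Re (h (displacement p q))"
    by (rule extremal_endpoint_local_extension[OF assms]) (assumption | rule that)+
  obtain R M where R: "R > 0"
    and RW: "\<And>x y z. x \<in> ball 0 R \<Longrightarrow> y \<in> ball 0 R \<Longrightarrow> z \<in> ball 0 R \<Longrightarrow> (x, y, z) \<in> W \<and> cmod (h (x, y, z)) \<le> M"
    by (rule polydisc_in_open_set[OF W]) (assumption | rule that)+
  define H where "H x y z = h (x, y, z)" for x y z
  have H1: "(\<lambda>x. H x y z) holomorphic_on ball 0 R" if "y \<in> ball 0 R" "z \<in> ball 0 R" for y z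
    unfolding holomorphic_on_def H_def
    using that by (intro ballI field_differentiable_at_within[OF h(1)] RW[THEN conjunct1])
  have H2: "(\<lambda>y. H x y z) holomorphic_on ball 0 R" if "x \<in> ball 0 R" "z \<in> ball 0 R" for x z
    unfolding holomorphic_on_def H_def
    using that by (intro ballI field_differentiable_at_within[OF h(2)] RW[THEN conjunct1])
  have H3: "(\<lambda>z. H x y z) holomorphic_on ball 0 R" if "x \<in> ball 0 R" "y \<in> ball 0 R" for x y
    unfolding holomorphic_on_def H_def
    using that by (intro ballI field_differentiable_at_within[OF h(3)] RW[THEN conjunct1])
  have H_bound: "cmod (H x y z) \<le> M" if "x \<in> ball 0 R" "y \<in> ball 0 R" "z \<in> ball 0 R" for x y z
    unfolding H_def using that by (rule RW[THEN conjunct2])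
  have H_real: "sub_Lorentzian_dist 0 q =
      Re (H (of_real (q $ 1 - p $ 1)) (of_real (q $ 2 - p $ 2)) (of_real (q $ 3 - p $ 3)))"
    if q: "q \<in> ball p (R / 2)" for q
  proof -
    have "complex_of_real (q $ i - p $ i) \<in> ball 0 R" for i
    proof -
      have "\<bar>q $ i - p $ i\<bar> < R"
        using component_le_norm_cart[of "q - p" i] q R by (simp add: dist_norm norm_minus_commute)
      then show ?thesis
        by (simp del: of_real_diff)
    qed
    then have "displacement p q \<in> W"
      unfolding displacement_def by (intro RW[THEN conjunct1])
    then show ?thesis
      using h(4) by (simp add: displacement_def H_def)
  qed
  show ?thesis
    by (rule real_power_series_3[OF R H1 H2 H3 H_bound H_real])
qed

lemma continuous_at_extremal_endpoint:
  assumes "extremal_endpoint a b p"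
  shows "isCont (sub_Lorentzian_dist 0) p"
proof -
  obtain W h where W: "open W" "(0, 0, 0) \<in> W" "continuous_on W h"
    and h: "\<And>x y z. (x, y, z) \<in> W \<Longrightarrow> (\<lambda>x. h (x, y, z)) field_differentiable (at x)"
    "\<And>x y z. (x, y, z) \<in> W \<Longrightarrow> (\<lambda>y. h (x, y, z)) field_differentiable (at y)"
    "\<And>x y z. (x, y, z) \<in> W \<Longrightarrow> (\<lambda>z. h (x, y, z)) field_differentiable (at z)"
    "\<And>q. displacement p q \<in> W \<Longrightarrow> sub_Lorentzian_dist 0 q = Re (h (displacement p q))"
    by (rule extremal_endpoint_local_extension[OF assms]) (assumption | rule that)+
  have pW: "displacement p p \<in> W"
    using W(2) by (simp add: displacement_def)
  have cont_h: "isCont h (displacement p p)"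
    using W(1,3) pW continuous_on_eq_continuous_at by blast
  have cont_d: "isCont (displacement p) p"
    using continuous_on_displacement by (simp add: continuous_on_eq_continuous_at)
  have "isCont (\<lambda>q. Re (h (displacement p q))) p"
    by (rule continuous_Re[OF isCont_o2[OF cont_d cont_h]])
  moreover have "\<forall>\<^sub>F q in nhds p. sub_Lorentzian_dist 0 q = Re (h (displacement p q))"
    using eventually_displacement_in[OF W(1,2)] by eventually_elim (rule h(4))
  ultimately show ?thesis
    by (simp cong: isCont_cong)
qed

text \<open>As the distance is nonnegative, an upper bound for it near \<open>p\<close> suffices wherever it vanishes.\<close>

lemma isCont_dist_if_eventually_small:
  assumes "\<And>e. e > 0 \<Longrightarrow> \<forall>\<^sub>F q in nhds p. sub_Lorentzian_dist 0 q < e"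
  shows "isCont (sub_Lorentzian_dist 0) p"
proof -
  have "sub_Lorentzian_dist 0 p < e" if "e > 0" for e
    using eventually_nhds_x_imp_x[OF assms[OF that]] .
  then have zero: "sub_Lorentzian_dist 0 p = 0"
    using sub_Lorentzian_dist_nonneg[of p] by (metis less_irrefl order_less_le)
  have "((sub_Lorentzian_dist 0) \<longlongrightarrow> 0) (at p)"
  proof (rule order_tendstoI)
    fix e :: real assume "e < 0"
    then show "\<forall>\<^sub>F q in at p. e < sub_Lorentzian_dist 0 q"
      using sub_Lorentzian_dist_nonneg by (auto intro!: always_eventually elim: less_le_trans)
  next
    fix e :: real assume "0 < e"
    then show "\<forall>\<^sub>F q in at p. sub_Lorentzian_dist 0 q < e"
      using assms eventually_nhds_conv_at by blast
  qed
  then show ?thesis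
    by (simp add: isCont_def zero)
qed

text \<open>The dual bound at the multipliers \<open>(n a, n b)\<close> is below \<open>e\<close> at \<open>p\<close> for large \<open>n\<close>. For this fixed \<open>n\<close>
it is continuous in the endpoint, hence below \<open>e\<close> near \<open>p\<close>; points that are not attainable have
distance zero by definition.\<close>

lemma continuous_at_supported:
  assumes X: "p $ 1 > 0" and ab: "(a, b) \<noteq> (0, 0)"
    "integral {0..1} (\<lambda>s. \<bar>a + b * s\<^sup>2\<bar>) \<le> a * (p $ 2 / p $ 1) + b * (2 * p $ 3 / (p $ 1) ^ 3)"
  shows "isCont (sub_Lorentzian_dist 0) p"
proof (rule isCont_dist_if_eventually_small)
  fix e :: real assume e: "e > 0"
  have "(\<lambda>n. p $ 1 * (energy (real n * a) (real n * b) - real n * integral {0..1} (\<lambda>s. \<bar>a + b * s\<^sup>2\<bar>))) \<longlonglongrightarrow> 0"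
    by (intro tendsto_mult_right_zero energy_minus_support_tendsto_0 ab)
  from order_tendstoD(2)[OF this e] obtain n where
    n: "p $ 1 * (energy (real n * a) (real n * b) - real n * integral {0..1} (\<lambda>s. \<bar>a + b * s\<^sup>2\<bar>)) < e"
    by (auto simp: eventually_sequentially)
  define B where "B q = q $ 1 * energy (real n * a) (real n * b)
      - (real n * a * q $ 2 + 2 * (real n * b) / (q $ 1)\<^sup>2 * q $ 3)" for q :: "real^3"
  have "B p < e"
  proof -
    have "B p = p $ 1 * (energy (real n * a) (real n * b)
        - real n * (a * (p $ 2 / p $ 1) + b * (2 * p $ 3 / (p $ 1) ^ 3)))"
      unfolding B_def normalised_pairing[OF X] by (simp add: algebra_simps)
    also have "\<dots> \<le> p $ 1 * (energy (real n * a) (real n * b) - real n * integral {0..1} (\<lambda>s. \<bar>a + b * s\<^sup>2\<bar>))"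
      using X ab(2) by (intro mult_left_mono diff_left_mono) auto
    finally show ?thesis using n by linarith
  qed
  moreover have "isCont B p"
    unfolding B_def[abs_def] using X by (intro continuous_intros) auto
  ultimately have "\<forall>\<^sub>F q in nhds p. B q < e"
    unfolding isCont_def tendsto_at_iff_tendsto_nhds by (intro order_tendstoD(2))
  moreover have "\<forall>\<^sub>F q in nhds p. q $ 1 > 0"
    using X by (intro eventually_nhds_in_open[of "{q. q $ 1 > 0}", simplified] open_Collect_less continuous_intros)
  ultimately show "\<forall>\<^sub>F q in nhds p. sub_Lorentzian_dist 0 q < e"
  proof eventually_elim
    case (elim q)
    then show ?case
      using sub_Lorentzian_dist_le_dual[of q "real n * a" "real n * b"] e
      by (cases "q \<in> attainable 0") (auto simp: B_def sub_Lorentzian_dist_def)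
  qed
qed

lemma continuous_at_nonpositive_abscissa:
  assumes "p $ 1 \<le> 0"
  shows "isCont (sub_Lorentzian_dist 0) p"
proof (rule isCont_dist_if_eventually_small)
  fix e :: real assume e: "e > 0"
  have "open {q :: real^3. q $ 1 < e}"
    by (intro open_Collect_less continuous_intros)
  then have "\<forall>\<^sub>F q in nhds p. q \<in> {q. q $ 1 < e}"
    using assms e by (intro eventually_nhds_in_open) auto
  then show "\<forall>\<^sub>F q in nhds p. sub_Lorentzian_dist 0 q < e"
  proof eventually_elim
    case (elim q)
    then show ?case
      using sub_Lorentzian_dist_le_abscissa[of q] e by simp
  qed
qed

theorem theorem14:
  shows "real_analytic_on (sub_Lorentzian_dist 0) (interior (attainable 0))
    \<and> continuous_on UNIV (sub_Lorentzian_dist 0)"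
proof
  show "real_analytic_on (sub_Lorentzian_dist 0) (interior (attainable 0))"
    unfolding real_analytic_on_def
    by (rule ballI, erule interior_attainable_extremal, erule extremal_endpoint_power_series)
  show "continuous_on UNIV (sub_Lorentzian_dist 0)"
  proof (rule continuous_at_imp_continuous_on, rule ballI)
    fix p :: "real^3"
    show "isCont (sub_Lorentzian_dist 0) p"
    proof (cases "p $ 1 > 0")
      case True
      show ?thesis
        by (rule extremal_or_supported[OF True])
          (erule continuous_at_extremal_endpoint, erule (1) continuous_at_supported[OF True])
    next
      case False
      then show ?thesis
        by (intro continuous_at_nonpositive_abscissa) simp
    qed
  qed
qed

end
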